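(* Let $(\tilde{S}_J[P_J])_{J\in\mathbb{N}}$ be any coherent sequence of scattering transforms on $\mathbb{R}^d$. Then, for each $f\in L^2(\mathbb{R}^d)$ and each $c\in\mathbb{R}^d$, $$\lim_{J\to\infty}\left\|\tilde{S}_J[P_J]f-\tilde{S}_J[P_J]T_cf\right\|_{L^2l^2}=0.$$
   Context: Functions are complex-valued on $\mathbb{R}^d$. The Fourier transform is normalized as $\hat{f}(\xi)=\int_{\mathbb{R}^d}f(x)e^{-2\pi i x\cdot\xi}\,dx$ (extended to $L^2$ by Plancherel). The supremum of the empty set is taken to be $0$. Translation: $(T_cf)(x):=f(x-c)$. A semi-discrete Bessel sequence is a sequence (countable family) $\mathcal{G}$ of functions in $L^1(\mathbb{R}^d)\cap L^2(\mathbb{R}^d)$ with $\sum_{g\in\mathcal{G}}|\hat{g}(\xi)|^2\leq 1$ for a.e. $\xi$. If $\mathcal{G}=\{g_\lambda\}_{\lambda\in\Lambda}\cup\{g_0\}$ for a set $\Lambda$ with $0\notin\Lambda$, we say $\mathcal{G}$ has index set $\Lambda$ and output-generating function $g_0$. Scattering propagator: for $p=(\lambda_1,\dots,\lambda_k)\in\Lambda^k$ and $f\in L^2(\mathbb{R}^d)$, define inductively $\tilde{U}[p]f:=f$ if $k=0$ (the empty path), and $\tilde{U}[p]f:=\left|\tilde{U}[\lambda_1,\dots,\lambda_{k-1}]f*g_{\lambda_k}\right|$ if $k\geq1$. Scattering transform: with $P:=\bigcup_{n=0}^\infty\Lambda^n$, $\tilde{S}[P]f:=\{\tilde{U}[p]f*g_0\}_{p\in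 P}$. For a family $\{h_p\}_{p\in P}$ of $L^2$ functions, $\|\{h_p\}\|_{L^2l^2}^2:=\sum_{p\in P}\|h_p\|_{L^2}^2$; differences of such families are taken entrywise. Coherent sequence: let $\{\mathcal{G}_J\}_{J\in\mathbb{N}}$ be a sequence of semi-discrete Bessel sequences with index sets $\Lambda_J$ and output-generating functions $g_{0,J}$, such that $\hat{g}_{0,J}$ is compactly supported for each $J$. Let $P_J:=\bigcup_{n=0}^\infty\Lambda_J^n$ and let $\tilde{S}_J[P_J]$ be the scattering transform associated with $\mathcal{G}_J$. The sequence of scattering transforms is called coherent if (1) $\mathcal{G}_J\setminus\{g_{0,J}\}\subseteq\mathcal{G}_{J+1}\setminus\{g_{0,J+1}\}$ for each $J$ (with index sets chosen consistently, so that $\Lambda_J\subseteq\Lambda_{J+1}$), and (2) $\lim_{J\to\infty}\sup\{|\xi| : \hat{g}_{0,J}(\xi)\neq0\}=0$. *)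

theory Defs
  imports "HOL-Analysis.Analysis"
begin

(* The domain is an arbitrary finite-dimensional Euclidean space 'a, e.g. real^'d.  Elements of
   L^1 and L^2 are represented by Lebesgue measurable functions. *)

definition L1 :: "('a::euclidean_space \<Rightarrow> complex) set" where
  "L1 = {f. integrable lebesgue f}"

definition L2 :: "('a::euclidean_space \<Rightarrow> complex) set" where
  "L2 = {f. f \<in> borel_measurable lebesgue \<and> integrable lebesgue (\<lambda>x. (cmod (f x))\<^sup>2)}"

definition ennreal_sqrt :: "ennreal \<Rightarrow> ennreal" where
  "ennreal_sqrt s = (if s = top then top else ennreal (sqrt (enn2real s)))"

definition L2_norm :: "('a::euclidean_space \<Rightarrow> complex) \<Rightarrow> ennreal" where
  "L2_norm h = ennreal_sqrt (\<integral>\<^sup>+ x. ennreal ((cmod (h x))\<^sup>2) \<partial>lebesgue)"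

(* Norm of a family (h p), p in P.  It takes the value top if the sum of squares diverges. *)
definition L2l2_norm :: "'p set \<Rightarrow> ('p \<Rightarrow> 'a::euclidean_space \<Rightarrow> complex) \<Rightarrow> ennreal" where
  "L2l2_norm P h = ennreal_sqrt (\<Sum>\<^sub>\<infinity>p\<in>P. (L2_norm (h p))\<^sup>2)"

(* Only applied to integrable functions below. *)
definition fourier :: "('a::euclidean_space \<Rightarrow> complex) \<Rightarrow> 'a \<Rightarrow> complex" where
  "fourier f \<xi> = (LINT x|lebesgue. f x * exp (- 2 * complex_of_real pi * \<i> * complex_of_real (x \<bullet> \<xi>)))"

(* For f in L^2 and g in L^1 \<inter> L^2, the only case needed, the integral exists for every x. *)
definition conv :: "('a::euclidean_space \<Rightarrow> complex) \<Rightarrow> ('a \<Rightarrow> complex) \<Rightarrow> 'a \<Rightarrow> complex" where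
  "conv f g x = (LINT y|lebesgue. f y * g (x - y))"

definition translate :: "'a::euclidean_space \<Rightarrow> ('a \<Rightarrow> complex) \<Rightarrow> 'a \<Rightarrow> complex" where
  "translate c f x = f (x - c)"

definition semidiscrete_bessel :: "'i set \<Rightarrow> ('i \<Rightarrow> 'a::euclidean_space \<Rightarrow> complex) \<Rightarrow> bool" where
  "semidiscrete_bessel I g \<longleftrightarrow>
     countable I \<and> (\<forall>i\<in>I. g i \<in> L1 \<inter> L2) \<and>
     (AE \<xi> in lebesgue. (\<Sum>\<^sub>\<infinity>i\<in>I. ennreal ((cmod (fourier (g i) \<xi>))\<^sup>2)) \<le> 1)"

(* The index 0 is reserved for the output-generating function g 0. *)
definition bessel_with_output ::
    "'i::zero set \<Rightarrow> ('i \<Rightarrow> 'a::euclidean_space \<Rightarrow> complex) \<Rightarrow> bool" where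
  "bessel_with_output \<Lambda> g \<longleftrightarrow> 0 \<notin> \<Lambda> \<and> semidiscrete_bessel (insert 0 \<Lambda>) g"

(* A path is the list of its indices; its first entry is applied first. *)
definition propagator ::
    "('i \<Rightarrow> 'a::euclidean_space \<Rightarrow> complex) \<Rightarrow> 'i list \<Rightarrow> ('a \<Rightarrow> complex) \<Rightarrow> 'a \<Rightarrow> complex" where
  "propagator g p f = foldl (\<lambda>h l x. complex_of_real (cmod (conv h (g l) x))) f p"

lemma propagator_Nil: "propagator g [] f = f"
  by (simp add: propagator_def)

lemma propagator_snoc:
  "propagator g (p @ [l]) f = (\<lambda>x. complex_of_real (cmod (conv (propagator g p f) (g l) x)))"
  by (simp add: propagator_def)

definition scattering ::
    "('i::zero \<Rightarrow> 'a::euclidean_space \<Rightarrow> complex) \<Rightarrow> ('a \<Rightarrow> complex) \<Rightarrow> 'i list \<Rightarrow> 'a \<Rightarrow> complex" where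
  "scattering g f p = conv (propagator g p f) (g 0)"

(* The inclusion of the generating functions is an inclusion of indexed families of L^1 \<inter> L^2
   classes, hence equality almost everywhere.  The supremum is taken in ennreal, where
   Sup {} = 0. *)
definition coherent ::
    "(nat \<Rightarrow> 'i::zero set) \<Rightarrow> (nat \<Rightarrow> 'i \<Rightarrow> 'a::euclidean_space \<Rightarrow> complex) \<Rightarrow> bool" where
  "coherent \<Lambda> G \<longleftrightarrow>
     (\<forall>J. bessel_with_output (\<Lambda> J) (G J)) \<and>
     (\<forall>J. compact (closure {\<xi>. fourier (G J 0) \<xi> \<noteq> 0})) \<and>
     (\<forall>J. \<Lambda> J \<subseteq> \<Lambda> (Suc J) \<and> (\<forall>l\<in>\<Lambda> J. AE x in lebesgue. G (Suc J) l x = G J l x)) \<and>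
     (\<lambda>J. SUP \<xi>\<in>{\<xi>. fourier (G J 0) \<xi> \<noteq> 0}. ennreal (norm \<xi>)) \<longlonglongrightarrow> 0"

end

theory Submission
  imports Defs "HOL-Probability.Characteristic_Functions"
begin

text \<open>
  Translation commutes with the propagator, so the difference of the two transforms at a path is
  the convolution of the propagated function with the difference of the output function and its
  translate by c.  The Fourier transform of that difference is the one of the output function times
  a factor of modulus at most \<open>\<epsilon>\<close>, where \<open>\<epsilon>\<close> is \<open>2 \<pi> |c|\<close> times the radius of its support.
  Hence the Bessel condition survives if the output function is replaced by this difference divided
  by \<open>\<epsilon>\<close>, and conservation of energy along the paths bounds the norm in question by \<open>\<epsilon>\<close> times the
  norm of f.

  The Bessel inequality for convolutions needs Plancherel only for bounded continuous integrable
  functions, where Gaussian regularization and dominated convergence suffice.  Fatou's lemma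
  extends the inequality to all of \<open>L\<^sup>2\<close>.
\<close>

subsection \<open>Fourier transform of Gaussians\<close>

text \<open>The modulus in each layer destroys phase information, so the L^2 norm is the quantity
  carried from layer to layer. The smallness is therefore placed entirely in the last convolution:
  \<epsilon> enters once per path, not once per layer, and the bound is independent of the path
  length. Hence the Bessel inequality is phrased with norms of convolutions in space and carried to
  L^2 by limits there, with no Fourier transform on L^2. Bounded continuous integrable functions are
  a convenient starting class because convolution with an L^1 function preserves it. Fubini and
  substitution are applied to Borel functions on \<open>lborel\<close>. Since \<open>conv\<close>
  and \<open>fourier\<close> do not see changes on null sets, Borel representatives suffice.
  Infinite families are reached through finite sets of paths, each of which involves finitely many
  indices.\<close>

lemma fourier_lborel:
  assumes [measurable]: "f \<in> borel_measurable borel"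
  shows "fourier f \<xi> = (LINT x|lborel. f x * cis (- (2 * pi * (x \<bullet> \<xi>))))"
  unfolding fourier_def
  by (subst integral_completion) (auto simp: cis_conv_exp mult_ac)

lemma integrable_mult_cis:
  fixes f :: "'a::euclidean_space \<Rightarrow> complex"
  assumes "integrable lborel f" and [measurable]: "t \<in> borel_measurable borel"
  shows "integrable lborel (\<lambda>x. f x * cis (t x))"
  by (rule Bochner_Integration.integrable_bound[OF assms(1)])
     (use assms(1) in \<open>auto simp: norm_mult cis_conv_exp\<close>)

lemma borel_measurable_cis [measurable (raw)]:
  "t \<in> borel_measurable M \<Longrightarrow> (\<lambda>x. cis (t x)) \<in> borel_measurable M"
  by (simp add: cis_conv_exp)

lemma integrable_lborel_tensor:
  fixes u :: "'a::euclidean_space \<Rightarrow> complex" and v :: "'b::euclidean_space \<Rightarrow> complex"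
  assumes u: "integrable lborel u" and v: "integrable lborel v"
  shows "integrable (lborel \<Otimes>\<^sub>M lborel) (\<lambda>(x, y). u x * v y)"
proof (rule lborel_pair.Fubini_integrable)
  have [measurable]: "u \<in> borel_measurable borel" "v \<in> borel_measurable borel"
    using u v by auto
  show "(\<lambda>(x, y). u x * v y) \<in> borel_measurable (lborel \<Otimes>\<^sub>M lborel)" by measurable
  show "integrable lborel (\<lambda>x. LINT y|lborel. norm (case (x, y) of (x, y) \<Rightarrow> u x * v y))"
    using u by (simp add: norm_mult)
  show "AE x in lborel. integrable lborel (\<lambda>y. case (x, y) of (x, y) \<Rightarrow> u x * v y)"
    using v by simp
qed

lemma borel_measurable_fourier [measurable]:
  fixes u :: "'a::euclidean_space \<Rightarrow> complex"
  assumes [measurable]: "u \<in> borel_measurable borel"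
  shows "fourier u \<in> borel_measurable borel"
proof -
  have "fourier u = (\<lambda>\<xi>. LINT x|lborel. u x * cis (- (2 * pi * (x \<bullet> \<xi>))))"
    by (simp add: fun_eq_iff fourier_lborel)
  then show ?thesis by simp
qed

lemma norm_fourier_le:
  fixes u :: "'a::euclidean_space \<Rightarrow> complex"
  assumes [measurable]: "u \<in> borel_measurable borel"
  shows "cmod (fourier u \<xi>) \<le> (LINT x|lborel. cmod (u x))"
  using integral_norm_bound[of lborel "\<lambda>x. u x * cis (- (2 * pi * (x \<bullet> \<xi>)))"]
  by (simp add: fourier_lborel norm_mult)

lemma integrable_fourier_mult:
  fixes u v :: "'a::euclidean_space \<Rightarrow> complex"
  assumes u: "integrable lborel u" and v: "integrable lborel v"
  shows "integrable lborel (\<lambda>\<xi>. fourier u \<xi> * v \<xi>)"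
proof (rule Bochner_Integration.integrable_bound)
  have [measurable]: "u \<in> borel_measurable borel" "v \<in> borel_measurable borel"
    using u v by auto
  show "integrable lborel (\<lambda>\<xi>. (LINT x|lborel. cmod (u x)) * cmod (v \<xi>))" using v by simp
  show "(\<lambda>\<xi>. fourier u \<xi> * v \<xi>) \<in> borel_measurable lborel" by measurable
  show "AE \<xi> in lborel. norm (fourier u \<xi> * v \<xi>) \<le> norm ((LINT x|lborel. cmod (u x)) * cmod (v \<xi>))"
    by (auto simp: norm_mult norm_fourier_le intro!: mult_mono)
qed

text \<open>Both sides are iterated integrals of \<open>u x * v \<xi>\<close> times a phase of
  modulus 1, so Fubini applies. It takes the place of Fourier inversion below.\<close>

lemma fourier_multiplication_formula:
  fixes u v :: "'a::euclidean_space \<Rightarrow> complex"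
  assumes u: "integrable lborel u" and v: "integrable lborel v"
  shows "(LINT \<xi>|lborel. fourier u \<xi> * v \<xi>) = (LINT x|lborel. u x * fourier v x)"
proof -
  have [measurable]: "u \<in> borel_measurable borel" "v \<in> borel_measurable borel"
    using u v by auto
  let ?F = "\<lambda>x \<xi>. u x * v \<xi> * cis (- (2 * pi * (x \<bullet> \<xi>)))"
  have int: "integrable (lborel \<Otimes>\<^sub>M lborel) (\<lambda>(x, \<xi>). ?F x \<xi>)"
    by (rule Bochner_Integration.integrable_bound[OF integrable_lborel_tensor[OF u v]])
       (auto simp: norm_mult)
  have "(LINT \<xi>|lborel. fourier u \<xi> * v \<xi>) = (LINT \<xi>|lborel. LINT x|lborel. ?F x \<xi>)"
    unfolding fourier_lborel[OF \<open>u \<in> borel_measurable borel\<close>]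
    by (subst integral_mult_left_zero[symmetric]) (simp add: mult_ac)
  also have "\<dots> = (LINT x|lborel. LINT \<xi>|lborel. ?F x \<xi>)"
    by (rule lborel_pair.Fubini_integral[OF int])
  also have "\<dots> = (LINT x|lborel. u x * fourier v x)"
    by (simp add: fourier_lborel mult.assoc inner_commute)
  finally show ?thesis .
qed

text \<open>\<open>lborel_eq\<close> presents Lebesgue measure as the image of the product of
  one-dimensional ones, which reduces Gaussian integrals to the real line.\<close>

lemma integral_lborel_prod:
  fixes f :: "'a::euclidean_space \<Rightarrow> real \<Rightarrow> complex"
  assumes f: "\<And>b. b \<in> Basis \<Longrightarrow> integrable lborel (f b)"
  shows "integrable lborel (\<lambda>x::'a. \<Prod>b\<in>Basis. f b (x \<bullet> b))"
    and "(LINT x|lborel. (\<Prod>b\<in>Basis. f b (x \<bullet> b))) = (\<Prod>b\<in>Basis. (LINT u|lborel. f b u))"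
proof -
  interpret product_sigma_finite "\<lambda>_::'a. lborel :: real measure" ..
  have [measurable]: "f b \<in> borel_measurable borel" if "b \<in> Basis" for b
    using f[OF that] by auto
  have eq: "(\<Sum>b\<in>Basis. x b *\<^sub>R b) \<bullet> b' = x b'" if "b' \<in> Basis" for x and b' :: 'a
    using that by simp
  have m: "(\<lambda>x::'a. \<Prod>b\<in>Basis. f b (x \<bullet> b)) \<in> borel_measurable borel"
    by measurable
  have d: "(\<lambda>x::'a \<Rightarrow> real. \<Sum>b\<in>Basis. x b *\<^sub>R b) \<in> (\<Pi>\<^sub>M b\<in>Basis. lborel) \<rightarrow>\<^sub>M borel"
    by measurable
  show "integrable lborel (\<lambda>x::'a. \<Prod>b\<in>Basis. f b (x \<bullet> b))"
    by (subst lborel_eq, subst integrable_distr_eq[OF d m])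
       (simp add: product_integrable_prod f cong: prod.cong)
  show "(LINT x|lborel. (\<Prod>b\<in>Basis. f b (x \<bullet> b))) = (\<Prod>b\<in>Basis. (LINT u|lborel. f b u))"
    by (subst lborel_eq, subst integral_distr[OF d m])
       (simp add: product_integral_prod f cong: prod.cong)
qed

text \<open>Up to the factor \<open>sqrt (2 * pi)\<close>, this is the characteristic function of
  the standard normal distribution at \<open>- (2 * pi * v)\<close>.\<close>

lemma fourier_gaussian_real:
  "(LINT u|lborel. complex_of_real (exp (- u\<^sup>2 / 2)) * cis (- (2 * pi * (v * u)))) =
     complex_of_real (sqrt (2 * pi) * exp (- (2 * pi * v)\<^sup>2 / 2))"
proof -
  have "complex_of_real (exp (- (2 * pi * v)\<^sup>2 / 2)) = char std_normal_distribution (- (2 * pi * v))"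
    by (simp add: char_std_normal_distribution)
  also have "\<dots> = (LINT u|lborel. std_normal_density u *\<^sub>R iexp (- (2 * pi * v) * u))"
    by (simp add: char_def integral_density normal_density_nonneg)
  also have "\<dots> = (LINT u|lborel. complex_of_real (1 / sqrt (2 * pi)) *
     (complex_of_real (exp (- u\<^sup>2 / 2)) * cis (- (2 * pi * (v * u)))))"
    by (simp add: std_normal_density_def scaleR_conv_of_real cis_conv_exp mult_ac)
  finally show ?thesis by (simp add: field_simps)
qed

lemma integrable_gaussian_real: "integrable lborel (\<lambda>u::real. exp (- u\<^sup>2 / 2))"
proof -
  have "integrable lborel (\<lambda>u. sqrt (2 * pi) * std_normal_density u)" by simp
  then show ?thesis by (simp add: std_normal_density_def)
qed

lemma borel_measurable_cnj [measurable (raw)]: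
  "f \<in> borel_measurable M \<Longrightarrow> (\<lambda>x. cnj (f x)) \<in> borel_measurable M"
  by (rule measurable_compose[OF _ borel_measurable_continuous_onI[OF continuous_on_cnj]])
     (auto intro: continuous_intros)

section \<open>Affine substitutions: dilations, reflections and translations\<close>

lemma integral_lborel_affine:
  fixes f :: "'a::euclidean_space \<Rightarrow> 'b::{banach, second_countable_topology}"
  assumes [measurable]: "f \<in> borel_measurable borel" and c: "c \<noteq> 0"
  shows "(LINT x|lborel. f x) = \<bar>c\<bar> ^ DIM('a) *\<^sub>R (LINT x|lborel. f (t + c *\<^sub>R x))"
  by (subst lborel_affine[OF c, of t]) (simp add: integral_density integral_distr)

lemma nn_integral_lborel_affine:
  fixes f :: "'a::euclidean_space \<Rightarrow> ennreal"
  assumes [measurable]: "f \<in> borel_measurable borel" and c: "c \<noteq> 0"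
  shows "(\<integral>\<^sup>+x. f x \<partial>lborel) = ennreal (\<bar>c\<bar> ^ DIM('a)) * (\<integral>\<^sup>+x. f (t + c *\<^sub>R x) \<partial>lborel)"
  by (subst lborel_affine[OF c, of t])
     (simp add: nn_integral_density nn_integral_distr nn_integral_cmult ennreal_power)

lemma integral_lborel_reflect:
  fixes f :: "'a::euclidean_space \<Rightarrow> 'b::{banach, second_countable_topology}"
  assumes "f \<in> borel_measurable borel"
  shows "(LINT y|lborel. f (x - y)) = (LINT y|lborel. f y)"
  using integral_lborel_affine[OF assms, of "-1" x] by simp

lemma nn_integral_lborel_reflect:
  fixes f :: "'a::euclidean_space \<Rightarrow> ennreal"
  assumes "f \<in> borel_measurable borel"
  shows "(\<integral>\<^sup>+y. f (x - y) \<partial>lborel) = (\<integral>\<^sup>+y. f y \<partial>lborel)"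
  using nn_integral_lborel_affine[OF assms, of "-1" x] by simp

lemma integrable_lborel_reflect:
  fixes f :: "'a::euclidean_space \<Rightarrow> 'b::{banach, second_countable_topology}"
  assumes f: "integrable lborel f"
  shows "integrable lborel (\<lambda>y. f (x - y))"
proof -
  have [measurable]: "f \<in> borel_measurable borel" using f by auto
  show ?thesis
    using f nn_integral_lborel_reflect[of "\<lambda>y. ennreal (norm (f y))" x]
    by (simp add: integrable_iff_bounded)
qed

lemma integrable_lborel_translate:
  fixes f :: "'a::euclidean_space \<Rightarrow> 'b::{banach, second_countable_topology}"
  assumes "integrable lborel f"
  shows "integrable lborel (\<lambda>y. f (y - x))"
  using integrable_lborel_reflect[OF integrable_lborel_reflect[OF assms, of 0], of x] by simp

section \<open>The Gaussian weight and its transform at all scales\<close>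

definition gauss :: "'a::euclidean_space \<Rightarrow> complex" where
  "gauss x = complex_of_real (exp (- (norm x)\<^sup>2 / 2))"

text \<open>This is the Fourier transform of \<open>gauss\<close> in the normalization with 2 pi in
  the exponent. As a product of normal densities it has integral 1, which makes its rescalings an
  approximate identity.\<close>

definition gauss_kernel :: "'a::euclidean_space \<Rightarrow> complex" where
  "gauss_kernel x = (\<Prod>b\<in>Basis. complex_of_real (normal_density 0 (1 / (2 * pi)) (x \<bullet> b)))"

lemma gauss_prod: "gauss x = (\<Prod>b\<in>Basis. complex_of_real (exp (- (x \<bullet> b)\<^sup>2 / 2)))"
proof -
  have "- (norm x)\<^sup>2 / 2 = (\<Sum>b\<in>Basis. - (x \<bullet> b)\<^sup>2 / 2)"
    unfolding power2_norm_eq_inner euclidean_inner[of x x]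
    by (simp add: power2_eq_square sum_negf flip: sum_divide_distrib)
  then show ?thesis unfolding gauss_def by (simp add: exp_sum)
qed

lemma gauss_measurable [measurable]: "gauss \<in> borel_measurable borel"
  unfolding gauss_def by measurable

lemma gauss_kernel_measurable [measurable]: "gauss_kernel \<in> borel_measurable borel"
  unfolding gauss_kernel_def by measurable

lemma integrable_gauss: "integrable lborel gauss"
  unfolding gauss_prod[abs_def]
  using integrable_gaussian_real by (intro integral_lborel_prod(1)) simp

lemma integrable_gauss_kernel: "integrable lborel (gauss_kernel :: 'a::euclidean_space \<Rightarrow> _)"
  and integral_gauss_kernel: "(LINT x|lborel. gauss_kernel (x::'a)) = 1"
proof -
  have int: "integrable lborel (\<lambda>u. complex_of_real (normal_density 0 (1 / (2 * pi)) u))"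
    by simp
  show "integrable lborel (gauss_kernel :: 'a \<Rightarrow> _)"
    unfolding gauss_kernel_def[abs_def] by (rule integral_lborel_prod(1)[OF int])
  show "(LINT x|lborel. gauss_kernel (x::'a)) = 1"
    unfolding gauss_kernel_def by (subst integral_lborel_prod(2)[OF int]) simp
qed

lemma fourier_gauss: "fourier gauss x = gauss_kernel x"
proof -
  have cis: "cis (- (2 * pi * (y \<bullet> x))) = (\<Prod>b\<in>Basis. cis (- (2 * pi * ((x \<bullet> b) * (y \<bullet> b)))))" for y
    by (simp add: cis_conv_exp euclidean_inner[of y x] sum_distrib_left sum_negf mult_ac
        flip: exp_sum)
  have int: "integrable lborel (\<lambda>u. complex_of_real (exp (- u\<^sup>2 / 2)) * cis (- (2 * pi * ((x \<bullet> b) * u))))" for b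
    using integrable_gaussian_real by (intro integrable_mult_cis) simp_all
  have "fourier gauss x = (LINT y|lborel. (\<Prod>b\<in>Basis. complex_of_real (exp (- (y \<bullet> b)\<^sup>2 / 2)) *
      cis (- (2 * pi * ((x \<bullet> b) * (y \<bullet> b))))))"
    by (simp only: fourier_lborel[OF gauss_measurable] gauss_prod cis prod.distrib)
  also have "\<dots> = (\<Prod>b\<in>Basis. complex_of_real (sqrt (2 * pi) * exp (- (2 * pi * (x \<bullet> b))\<^sup>2 / 2)))"
    by (subst integral_lborel_prod(2)[OF int]) (simp only: fourier_gaussian_real)
  \<comment> \<open>For standard deviation 1/(2 pi) the normalizing factor of the normal density is
    \<open>sqrt (2 * pi)\<close>, and its exponent at v is -(2 pi v)^2 / 2.\<close>
  also have "\<dots> = gauss_kernel x"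
    unfolding gauss_kernel_def normal_density_def
    by (intro prod.cong refl arg_cong[where f=complex_of_real])
       (simp add: power_divide power_mult_distrib real_sqrt_divide field_simps power2_eq_square)
  finally show ?thesis .
qed

text \<open>The transform of a Gaussian dilated by s is \<open>gauss_kernel\<close> concentrated at
  scale s. Substituting s z for z moves s into the argument of \<open>u\<close>; the kernel is then
  fixed and can serve in a dominating function as s tends to 0.\<close>

lemma integral_mult_fourier_gauss_scale:
  fixes u :: "'a::euclidean_space \<Rightarrow> complex"
  assumes [measurable]: "u \<in> borel_measurable borel" and s: "s > 0"
  shows "(LINT z|lborel. u z * fourier (\<lambda>\<xi>. gauss (s *\<^sub>R \<xi>)) z) =
    (LINT z|lborel. u (s *\<^sub>R z) * gauss_kernel z)"
proof -
  let ?W = "\<lambda>\<xi>::'a. gauss (s *\<^sub>R \<xi>)"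
  have k: "gauss_kernel z = s ^ DIM('a) *\<^sub>R fourier ?W (s *\<^sub>R z)" for z :: 'a
    using s integral_lborel_affine[of "\<lambda>y. gauss y * cis (- (2 * pi * (y \<bullet> z)))" s 0]
    by (simp add: fourier_lborel flip: fourier_gauss)
  have "(LINT z|lborel. u z * fourier ?W z) =
      s ^ DIM('a) *\<^sub>R (LINT z|lborel. u (s *\<^sub>R z) * fourier ?W (s *\<^sub>R z))"
    using s integral_lborel_affine[of "\<lambda>z. u z * fourier ?W z" s 0] by simp
  also have "\<dots> = (LINT z|lborel. u (s *\<^sub>R z) * gauss_kernel z)"
    by (simp add: k flip: integral_scaleR_right)
  finally show ?thesis .
qed

lemma fourier_reflect_cnj:
  fixes F :: "'a::euclidean_space \<Rightarrow> complex"
  assumes [measurable]: "F \<in> borel_measurable borel"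
  shows "fourier (\<lambda>z. cnj (F (x - z))) \<xi> = cnj (fourier F \<xi>) * cis (- (2 * pi * (x \<bullet> \<xi>)))"
proof -
  have "fourier (\<lambda>z. cnj (F (x - z))) \<xi> = (LINT z|lborel. cnj (F (x - z)) * cis (- (2 * pi * (z \<bullet> \<xi>))))"
    by (simp add: fourier_lborel)
  also have "\<dots> = (LINT y|lborel. cnj (F y) * cis (- (2 * pi * ((x - y) \<bullet> \<xi>))))"
    using integral_lborel_reflect[of "\<lambda>y. cnj (F y) * cis (- (2 * pi * ((x - y) \<bullet> \<xi>)))" x] by simp
  also have "\<dots> = (LINT y|lborel. cnj (F y * cis (- (2 * pi * (y \<bullet> \<xi>)))) * cis (- (2 * pi * (x \<bullet> \<xi>))))"
    by (simp add: cis_cnj cis_mult inner_diff_left algebra_simps)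
  also have "\<dots> = cnj (fourier F \<xi>) * cis (- (2 * pi * (x \<bullet> \<xi>)))"
    by (simp add: fourier_lborel del: complex_cnj_mult)
  finally show ?thesis .
qed

lemma integrable_gauss_scale:
  assumes "s > 0" shows "integrable lborel (\<lambda>\<xi>::'a::euclidean_space. gauss (s *\<^sub>R \<xi>))"
proof -
  have "(\<integral>\<^sup>+x. ennreal (norm (gauss (x::'a))) \<partial>lborel) =
     ennreal (\<bar>s\<bar> ^ DIM('a)) * (\<integral>\<^sup>+x. ennreal (norm (gauss (s *\<^sub>R (x::'a)))) \<partial>lborel)"
    using nn_integral_lborel_affine[of "\<lambda>x::'a. ennreal (norm (gauss x))" s 0] assms by simp
  moreover have "(\<integral>\<^sup>+x. ennreal (norm (gauss (x::'a))) \<partial>lborel) < \<infinity>"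
    using integrable_gauss by (simp add: integrable_iff_bounded)
  ultimately show ?thesis
    using assms by (auto simp: integrable_iff_bounded ennreal_mult_less_top)
qed

text \<open>The multiplication formula is used twice: once to move the transform from
  \<open>F\<close> to \<open>v\<close>, and once to evaluate the transform of \<open>v\<close> as a
  smoothed conjugate of \<open>F\<close>.\<close>

lemma fourier_gauss_energy:
  fixes F :: "'a::euclidean_space \<Rightarrow> complex"
  assumes F: "integrable lborel F" and s: "s > 0"
  shows "integrable lborel (\<lambda>\<xi>. (fourier F \<xi> * cnj (fourier F \<xi>)) * gauss (s *\<^sub>R \<xi>))"
    and "(LINT \<xi>|lborel. (fourier F \<xi> * cnj (fourier F \<xi>)) * gauss (s *\<^sub>R \<xi>)) =
      (LINT x|lborel. F x * (LINT z|lborel. cnj (F (x - s *\<^sub>R z)) * gauss_kernel z))"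
proof -
  have [measurable]: "F \<in> borel_measurable borel" using F by auto
  let ?W = "\<lambda>\<xi>::'a. gauss (s *\<^sub>R \<xi>)"
  \<comment> \<open>Chosen so that \<open>fourier F \<xi> * v \<xi>\<close> is the energy density
    damped by the real Gaussian weight; the weight makes \<open>v\<close> integrable.\<close>
  define v where "v = (\<lambda>\<xi>. cnj (fourier F \<xi> * ?W \<xi>))"
  have v: "integrable lborel v" unfolding v_def
    using integrable_fourier_mult[OF F integrable_gauss_scale[OF s]] by (simp only: integrable_cnj)
  have [measurable]: "v \<in> borel_measurable borel" using v by auto
  have eq: "fourier F \<xi> * v \<xi> = (fourier F \<xi> * cnj (fourier F \<xi>)) * gauss (s *\<^sub>R \<xi>)" for \<xi>
    by (simp add: v_def gauss_def mult_ac)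
  show "integrable lborel (\<lambda>\<xi>. (fourier F \<xi> * cnj (fourier F \<xi>)) * gauss (s *\<^sub>R \<xi>))"
    using integrable_fourier_mult[OF F v] by (simp only: eq)
  have fv: "fourier v x = (LINT z|lborel. cnj (F (x - s *\<^sub>R z)) * gauss_kernel z)" for x
  proof -
    have "fourier v x = (LINT \<xi>|lborel. fourier (\<lambda>z. cnj (F (x - z))) \<xi> * ?W \<xi>)"
      by (simp add: fourier_lborel[of v] fourier_reflect_cnj)
         (simp add: v_def gauss_def mult_ac inner_commute)
    also have "\<dots> = (LINT z|lborel. cnj (F (x - z)) * fourier ?W z)"
      using F by (intro fourier_multiplication_formula integrable_gauss_scale s)
        (simp add: integrable_lborel_reflect)
    also have "\<dots> = (LINT z|lborel. cnj (F (x - s *\<^sub>R z)) * gauss_kernel z)"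
      by (rule integral_mult_fourier_gauss_scale[OF _ s]) measurable
    finally show ?thesis .
  qed
  show "(LINT \<xi>|lborel. (fourier F \<xi> * cnj (fourier F \<xi>)) * gauss (s *\<^sub>R \<xi>)) =
      (LINT x|lborel. F x * (LINT z|lborel. cnj (F (x - s *\<^sub>R z)) * gauss_kernel z))"
    using fourier_multiplication_formula[OF F v] by (simp only: eq fv)
qed

subsection \<open>Plancherel identity\<close>

text \<open>Let the width s of the regularization tend to 0 in \<open>fourier_gauss_energy\<close>.
  On the frequency side the weight increases to 1; on the space side the smoothed function
  \<open>A x n\<close> tends to \<open>cnj (F x)\<close> at every x by continuity and stays
  bounded.\<close>

lemma plancherel_bounded_continuous:
  fixes F :: "'a::euclidean_space \<Rightarrow> complex"
  assumes F: "integrable lborel F" and cont: "continuous_on UNIV F" and bound: "\<And>x. cmod (F x) \<le> M"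
  shows "(\<integral>\<^sup>+\<xi>. ennreal ((cmod (fourier F \<xi>))\<^sup>2) \<partial>lborel) = (\<integral>\<^sup>+x. ennreal ((cmod (F x))\<^sup>2) \<partial>lborel)"
proof -
  have [measurable]: "F \<in> borel_measurable borel" using F by auto
  have M: "M \<ge> 0" using bound[of 0] norm_ge_zero order_trans by blast
  define s where "s n = 1 / real (Suc n)" for n
  have s_pos: "s n > 0" for n by (simp add: s_def)
  have s_lim: "s \<longlonglongrightarrow> 0" unfolding s_def
    using LIMSEQ_inverse_real_of_nat by (simp add: inverse_eq_divide)
  define A where "A x n = (LINT z|lborel. cnj (F (x - s n *\<^sub>R z)) * gauss_kernel z)" for x n
  have dom: "integrable lborel (\<lambda>z::'a. M * cmod (gauss_kernel z))"
    using integrable_norm[OF integrable_gauss_kernel[where 'a='a]] by simp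
  have le: "cmod (cnj (F y) * gauss_kernel z) \<le> M * cmod (gauss_kernel z)" for y z :: 'a
    using bound[of y] by (auto simp: norm_mult intro!: mult_right_mono)
  have A_lim: "A x \<longlonglongrightarrow> cnj (F x)" for x
  proof -
    have "A x \<longlonglongrightarrow> (LINT z|lborel. cnj (F x) * gauss_kernel (z::'a))" unfolding A_def
    proof (rule integral_dominated_convergence)
      show "integrable lborel (\<lambda>z::'a. M * cmod (gauss_kernel z))" by (rule dom)
      show "AE z in lborel. (\<lambda>n. cnj (F (x - s n *\<^sub>R z)) * gauss_kernel z) \<longlonglongrightarrow> cnj (F x) * gauss_kernel z"
      proof (rule AE_I2)
        fix z :: 'a
        have "(\<lambda>n. x - s n *\<^sub>R z) \<longlonglongrightarrow> x - 0 *\<^sub>R z" by (intro tendsto_intros s_lim)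
        then have "(\<lambda>n. F (x - s n *\<^sub>R z)) \<longlonglongrightarrow> F x"
          using cont by (intro isCont_tendsto_compose[of x F]) (auto simp: continuous_on_eq_continuous_at)
        then show "(\<lambda>n. cnj (F (x - s n *\<^sub>R z)) * gauss_kernel z) \<longlonglongrightarrow> cnj (F x) * gauss_kernel z"
          by (intro tendsto_intros)
      qed
      show "\<And>n. AE z in lborel. norm (cnj (F (x - s n *\<^sub>R z)) * gauss_kernel z) \<le> M * cmod (gauss_kernel z)"
        using le by auto
    qed measurable
    then show ?thesis by (simp add: integral_gauss_kernel)
  qed
  have A_bound: "cmod (A x n) \<le> M * (LINT z|lborel. cmod (gauss_kernel (z::'a)))" for x n
  proof -
    have "cmod (A x n) \<le> (LINT z|lborel. M * cmod (gauss_kernel (z::'a)))"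
      unfolding A_def by (rule order_trans[OF integral_norm_bound integral_mono'[OF dom]]) (use le M in auto)
    then show ?thesis by simp
  qed
  have A_meas [measurable]: "(\<lambda>x. A x n) \<in> borel_measurable borel" for n
    unfolding A_def by measurable
  define B where "B = M * (LINT z|lborel. cmod (gauss_kernel (z::'a)))"
  have lim1: "(\<lambda>n. LINT x|lborel. F x * A x n) \<longlonglongrightarrow> (LINT x|lborel. F x * cnj (F x))"
  proof (rule integral_dominated_convergence)
    show "integrable lborel (\<lambda>x. cmod (F x) * B)" using F by simp
    show "AE x in lborel. (\<lambda>n. F x * A x n) \<longlonglongrightarrow> F x * cnj (F x)"
      by (intro AE_I2 tendsto_intros A_lim)
    show "AE x in lborel. norm (F x * A x n) \<le> cmod (F x) * B" for n
      using A_bound[of _ n] by (auto simp: norm_mult B_def intro!: mult_left_mono)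
  qed measurable
  have intF2: "integrable lborel (\<lambda>x. (cmod (F x))\<^sup>2)"
  proof (rule Bochner_Integration.integrable_bound)
    show "integrable lborel (\<lambda>x. M * cmod (F x))" using F by simp
    show "AE x in lborel. norm ((cmod (F x))\<^sup>2) \<le> norm (M * cmod (F x))"
      using bound M by (auto simp: power2_eq_square intro!: mult_right_mono)
  qed measurable
  \<comment> \<open>The damped energy density as a real function, so that the complex identity can
    be transferred to nonnegative integrals.\<close>
  define w where "w n \<xi> = (cmod (fourier F \<xi>))\<^sup>2 * exp (- (norm (s n *\<^sub>R \<xi>))\<^sup>2 / 2)" for n and \<xi> :: 'a
  have w_eq: "complex_of_real (w n \<xi>) = (fourier F \<xi> * cnj (fourier F \<xi>)) * gauss (s n *\<^sub>R \<xi>)" for n \<xi>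
    by (simp only: w_def gauss_def of_real_mult complex_norm_square)
  have w_int: "integrable lborel (w n)" for n
    using fourier_gauss_energy(1)[OF F s_pos] unfolding w_eq[symmetric] by (simp only: complex_of_real_integrable_eq)
  have w_eq2: "complex_of_real (LINT \<xi>|lborel. w n \<xi>) = (LINT x|lborel. F x * A x n)" for n
    using fourier_gauss_energy(2)[OF F s_pos] unfolding w_eq[symmetric] A_def by simp
  have w_lim: "(\<lambda>n. LINT \<xi>|lborel. w n \<xi>) \<longlonglongrightarrow> (LINT x|lborel. (cmod (F x))\<^sup>2)"
  proof -
    have "(\<lambda>n. complex_of_real (LINT \<xi>|lborel. w n \<xi>)) \<longlonglongrightarrow> complex_of_real (LINT x|lborel. (cmod (F x))\<^sup>2)"
      unfolding w_eq2 unfolding integral_complex_of_real[symmetric] complex_norm_square by (rule lim1)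
    then show ?thesis by (simp only: tendsto_of_real_iff)
  qed
  have w_nn: "w n \<xi> \<ge> 0" for n \<xi> by (simp add: w_def)
  have "(\<lambda>n. \<integral>\<^sup>+\<xi>. ennreal (w n \<xi>) \<partial>lborel) \<longlonglongrightarrow> (\<integral>\<^sup>+\<xi>. ennreal ((cmod (fourier F \<xi>))\<^sup>2) \<partial>lborel)"
  \<comment> \<open>Monotone convergence, because the square integrability of
    \<open>fourier F\<close> is not yet known and no dominating function is at hand.\<close>
  proof (rule nn_integral_LIMSEQ)
    show "mono (\<lambda>n \<xi>. ennreal (w n \<xi>))"
    proof (intro monoI le_funI ennreal_leI)
      fix m n :: nat and \<xi> :: 'a assume "m \<le> n"
      then have "s n \<le> s m" by (simp add: s_def frac_le)
      then have "(norm (s n *\<^sub>R \<xi>))\<^sup>2 \<le> (norm (s m *\<^sub>R \<xi>))\<^sup>2"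
        using s_pos[of n] s_pos[of m] by (intro power_mono) (auto intro!: mult_right_mono)
      then show "w m \<xi> \<le> w n \<xi>" by (auto simp: w_def intro!: mult_left_mono)
    qed
    show "(\<lambda>\<xi>. ennreal (w n \<xi>)) \<in> borel_measurable lborel" for n
      unfolding w_def by measurable
    fix \<xi> :: 'a
    have "(\<lambda>n. w n \<xi>) \<longlonglongrightarrow> (cmod (fourier F \<xi>))\<^sup>2 * exp (- (norm (0 *\<^sub>R \<xi>))\<^sup>2 / 2)"
      unfolding w_def by (intro tendsto_intros s_lim) simp
    then show "(\<lambda>n. ennreal (w n \<xi>)) \<longlonglongrightarrow> ennreal ((cmod (fourier F \<xi>))\<^sup>2)"
      by (intro tendsto_ennrealI) simp
  qed
  moreover have "(\<integral>\<^sup>+\<xi>. ennreal (w n \<xi>) \<partial>lborel) = ennreal (LINT \<xi>|lborel. w n \<xi>)" for n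
    by (intro nn_integral_eq_integral w_int) (simp add: w_nn)
  ultimately have "(\<lambda>n. ennreal (LINT \<xi>|lborel. w n \<xi>)) \<longlonglongrightarrow> (\<integral>\<^sup>+\<xi>. ennreal ((cmod (fourier F \<xi>))\<^sup>2) \<partial>lborel)"
    by simp
  from LIMSEQ_unique[OF this tendsto_ennrealI[OF w_lim]]
  show ?thesis by (subst nn_integral_eq_integral[OF intF2]) auto
qed

text \<open>Fubini for \<open>h y * g (x - y)\<close>: integrating over x first turns the shift by y
  into a phase, which is the one in the transform of \<open>h\<close>.\<close>

lemma fourier_conv_lborel:
  fixes h g :: "'a::euclidean_space \<Rightarrow> complex"
  assumes h: "integrable lborel h" and g: "integrable lborel g"
  defines "F \<equiv> \<lambda>x. LINT y|lborel. h y * g (x - y)"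
  shows "integrable lborel F" and "fourier F \<xi> = fourier h \<xi> * fourier g \<xi>"
proof -
  have [measurable]: "h \<in> borel_measurable borel" "g \<in> borel_measurable borel"
    using h g by auto
  have g_int: "(LINT x|lborel. cmod (g (x - y))) = (LINT x|lborel. cmod (g x))" for y
    using integral_lborel_affine[of "\<lambda>x. cmod (g (x - y))" 1 y] by simp
  have int: "integrable (lborel \<Otimes>\<^sub>M lborel) (\<lambda>(y, x). h y * g (x - y))"
  proof (rule lborel_pair.Fubini_integrable)
    show "(\<lambda>(y, x). h y * g (x - y)) \<in> borel_measurable (lborel \<Otimes>\<^sub>M lborel)" by measurable
    show "integrable lborel (\<lambda>y. LINT x|lborel. norm (case (y, x) of (y, x) \<Rightarrow> h y * g (x - y)))"
      using h by (simp add: norm_mult g_int)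
    show "AE y in lborel. integrable lborel (\<lambda>x. case (y, x) of (y, x) \<Rightarrow> h y * g (x - y))"
      using integrable_lborel_translate[OF g] by simp
  qed
  show Fint: "integrable lborel F" unfolding F_def by (rule lborel_pair.integrable_snd[OF int])
  then have [measurable]: "F \<in> borel_measurable borel" by auto
  have int2: "integrable (lborel \<Otimes>\<^sub>M lborel) (\<lambda>(y, x). h y * g (x - y) * cis (- (2 * pi * (x \<bullet> \<xi>))))"
    by (rule Bochner_Integration.integrable_bound[OF int]) (auto simp: norm_mult)
  have inner: "(LINT x|lborel. g (x - y) * cis (- (2 * pi * (x \<bullet> \<xi>)))) =
      cis (- (2 * pi * (y \<bullet> \<xi>))) * fourier g \<xi>" for y
  proof -
    have "(LINT x|lborel. g (x - y) * cis (- (2 * pi * (x \<bullet> \<xi>)))) =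
       (LINT x|lborel. g x * cis (- (2 * pi * ((y + x) \<bullet> \<xi>))))"
      using integral_lborel_affine[of "\<lambda>x. g (x - y) * cis (- (2 * pi * (x \<bullet> \<xi>)))" 1 y] by simp
    also have "\<dots> = (LINT x|lborel. cis (- (2 * pi * (y \<bullet> \<xi>))) * (g x * cis (- (2 * pi * (x \<bullet> \<xi>)))))"
      by (simp add: inner_add_left cis_mult algebra_simps)
    finally show ?thesis by (simp add: fourier_lborel)
  qed
  have "fourier F \<xi> = (LINT x|lborel. LINT y|lborel. h y * g (x - y) * cis (- (2 * pi * (x \<bullet> \<xi>))))"
    by (simp add: fourier_lborel[of F]) (simp add: F_def)
  also have "\<dots> = (LINT y|lborel. LINT x|lborel. h y * g (x - y) * cis (- (2 * pi * (x \<bullet> \<xi>))))"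
    by (rule lborel_pair.Fubini_integral[OF int2])
  also have "\<dots> = (LINT y|lborel. h y * (cis (- (2 * pi * (y \<bullet> \<xi>))) * fourier g \<xi>))"
    unfolding inner[symmetric]
    by (subst integral_mult_right_zero[symmetric]) (simp add: mult_ac)
  also have "\<dots> = fourier h \<xi> * fourier g \<xi>"
    by (simp add: fourier_lborel[of h] flip: mult.assoc)
  finally show "fourier F \<xi> = fourier h \<xi> * fourier g \<xi>" .
qed

subsection \<open>Bessel inequality for convolutions\<close>

lemma conv_lborel:
  assumes [measurable]: "h \<in> borel_measurable borel" "g \<in> borel_measurable borel"
  shows "conv h g x = (LINT y|lborel. h y * g (x - y))"
  unfolding conv_def by (subst integral_completion) auto

lemma borel_measurable_conv [measurable]:
  fixes h g :: "'a::euclidean_space \<Rightarrow> complex"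
  assumes [measurable]: "h \<in> borel_measurable borel" "g \<in> borel_measurable borel"
  shows "conv h g \<in> borel_measurable borel"
proof -
  have "conv h g = (\<lambda>x. LINT y|lborel. h y * g (x - y))" by (simp add: fun_eq_iff conv_lborel)
  then show ?thesis by simp
qed

text \<open>Together with integrability this makes \<open>plancherel_bounded_continuous\<close>
  applicable to the convolution itself.\<close>

lemma continuous_conv:
  fixes h g :: "'a::euclidean_space \<Rightarrow> complex"
  assumes cont: "continuous_on UNIV h" and bound: "\<And>x. cmod (h x) \<le> M" and g: "integrable lborel g"
  shows "continuous_on UNIV (conv h g)" and "cmod (conv h g x) \<le> M * (LINT y|lborel. cmod (g y))"
proof -
  have [measurable]: "g \<in> borel_measurable borel" using g by auto
  have [measurable]: "h \<in> borel_measurable borel" by (rule borel_measurable_continuous_onI[OF cont])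
  \<comment> \<open>The reflection puts x into the continuous factor, so that the integrable factor
    dominates uniformly in x.\<close>
  have eq: "conv h g x = (LINT y|lborel. h (x - y) * g y)" for x
    using integral_lborel_reflect[of "\<lambda>y. h (x - y) * g y" x] by (simp add: conv_lborel)
  have dom: "integrable lborel (\<lambda>y. M * cmod (g y))" using integrable_norm[OF g] by simp
  have le: "cmod (h y * g z) \<le> M * cmod (g z)" for y z
    using bound[of y] by (auto simp: norm_mult intro!: mult_right_mono)
  show "cmod (conv h g x) \<le> M * (LINT y|lborel. cmod (g y))"
    unfolding eq integral_mult_right_zero[symmetric]
    by (rule order_trans[OF integral_norm_bound integral_mono'[OF dom]])
       (use le order_trans[OF norm_ge_zero bound] in auto)
  show "continuous_on UNIV (conv h g)"
  proof (rule continuous_on_sequentiallyI)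
    fix X :: "nat \<Rightarrow> 'a" and x assume X: "X \<longlonglongrightarrow> x"
    show "(\<lambda>n. conv h g (X n)) \<longlonglongrightarrow> conv h g x"
      unfolding eq
    proof (rule integral_dominated_convergence)
      show "integrable lborel (\<lambda>z. M * cmod (g z))" by (rule dom)
      show "AE y in lborel. (\<lambda>n. h (X n - y) * g y) \<longlonglongrightarrow> h (x - y) * g y"
      proof (rule AE_I2, rule tendsto_mult[OF _ tendsto_const])
        fix y
        have "(\<lambda>n. X n - y) \<longlonglongrightarrow> x - y" by (intro tendsto_intros X)
        then show "(\<lambda>n. h (X n - y)) \<longlonglongrightarrow> h (x - y)"
          using cont by (intro isCont_tendsto_compose[of "x - y" h]) (auto simp: continuous_on_eq_continuous_at)
      qed
      show "\<And>n. AE y in lborel. norm (h (X n - y) * g y) \<le> M * cmod (g y)" using le by simp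
    qed measurable
  qed
qed

text \<open>Values in \<open>ennreal\<close> keep the inequality meaningful before the convolutions
  are known to be square integrable. It is applied to finite \<open>I\<close> only.\<close>

definition bessel_bound :: "'i set \<Rightarrow> ('i \<Rightarrow> 'a::euclidean_space \<Rightarrow> complex) \<Rightarrow> ('a \<Rightarrow> complex) \<Rightarrow> bool" where
  "bessel_bound I g h \<longleftrightarrow>
     (\<Sum>i\<in>I. \<integral>\<^sup>+x. ennreal ((cmod (conv h (g i) x))\<^sup>2) \<partial>lborel) \<le> (\<integral>\<^sup>+x. ennreal ((cmod (h x))\<^sup>2) \<partial>lborel)"

text \<open>By Plancherel the left side is the integral of the energy density of
  \<open>fourier h\<close> times the sum of the \<open>(cmod (fourier (g i) \<xi>))\<^sup>2\<close>,
  and that sum is at most 1 almost everywhere.\<close>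

lemma bessel_bound_continuous:
  fixes g :: "'i \<Rightarrow> 'a::euclidean_space \<Rightarrow> complex"
  assumes I: "finite I" and g: "\<And>i. i \<in> I \<Longrightarrow> integrable lborel (g i)"
    and bessel: "AE \<xi> in lborel. (\<Sum>i\<in>I. (cmod (fourier (g i) \<xi>))\<^sup>2) \<le> 1"
    and cont: "continuous_on UNIV h" and bound: "\<And>x. cmod (h x) \<le> M" and h: "integrable lborel h"
  shows "bessel_bound I g h"
  unfolding bessel_bound_def
proof -
  have [measurable]: "h \<in> borel_measurable borel" using h by auto
  have g_meas [measurable]: "g i \<in> borel_measurable borel" if "i \<in> I" for i using g[OF that] by auto
  have "(\<integral>\<^sup>+x. ennreal ((cmod (conv h (g i) x))\<^sup>2) \<partial>lborel) =
      (\<integral>\<^sup>+\<xi>. ennreal ((cmod (fourier h \<xi>))\<^sup>2) * ennreal ((cmod (fourier (g i) \<xi>))\<^sup>2) \<partial>lborel)"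
    if i: "i \<in> I" for i
  proof -
    have eq: "conv h (g i) = (\<lambda>x. LINT y|lborel. h y * g i (x - y))"
      using i by (simp add: conv_lborel fun_eq_iff)
    have "integrable lborel (conv h (g i))"
      unfolding eq by (rule fourier_conv_lborel(1)[OF h g[OF i]])
    then have "(\<integral>\<^sup>+x. ennreal ((cmod (conv h (g i) x))\<^sup>2) \<partial>lborel) =
        (\<integral>\<^sup>+\<xi>. ennreal ((cmod (fourier (conv h (g i)) \<xi>))\<^sup>2) \<partial>lborel)"
      using continuous_conv[OF cont bound g[OF i]]
      by (intro plancherel_bounded_continuous[symmetric])
    then show ?thesis
      unfolding eq fourier_conv_lborel(2)[OF h g[OF i]]
      by (simp add: norm_mult power_mult_distrib ennreal_mult)
  qed
  then have "(\<Sum>i\<in>I. \<integral>\<^sup>+x. ennreal ((cmod (conv h (g i) x))\<^sup>2) \<partial>lborel) =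
      (\<Sum>i\<in>I. \<integral>\<^sup>+\<xi>. ennreal ((cmod (fourier h \<xi>))\<^sup>2) * ennreal ((cmod (fourier (g i) \<xi>))\<^sup>2) \<partial>lborel)"
    by simp
  also have "\<dots> = (\<integral>\<^sup>+\<xi>. (\<Sum>i\<in>I. ennreal ((cmod (fourier h \<xi>))\<^sup>2) * ennreal ((cmod (fourier (g i) \<xi>))\<^sup>2)) \<partial>lborel)"
    by (rule nn_integral_sum[symmetric]) measurable
  also have "\<dots> \<le> (\<integral>\<^sup>+\<xi>. ennreal ((cmod (fourier h \<xi>))\<^sup>2) \<partial>lborel)"
  proof (rule nn_integral_mono_AE)
    show "AE \<xi> in lborel. (\<Sum>i\<in>I. ennreal ((cmod (fourier h \<xi>))\<^sup>2) * ennreal ((cmod (fourier (g i) \<xi>))\<^sup>2))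
        \<le> ennreal ((cmod (fourier h \<xi>))\<^sup>2)"
      using bessel
    proof (rule AE_mp, intro AE_I2 impI)
      fix \<xi> assume "(\<Sum>i\<in>I. (cmod (fourier (g i) \<xi>))\<^sup>2) \<le> 1"
      then have "(cmod (fourier h \<xi>))\<^sup>2 * (\<Sum>i\<in>I. (cmod (fourier (g i) \<xi>))\<^sup>2) \<le> (cmod (fourier h \<xi>))\<^sup>2 * 1"
        by (intro mult_left_mono) auto
      then show "(\<Sum>i\<in>I. ennreal ((cmod (fourier h \<xi>))\<^sup>2) * ennreal ((cmod (fourier (g i) \<xi>))\<^sup>2))
          \<le> ennreal ((cmod (fourier h \<xi>))\<^sup>2)"
        by (simp add: sum_distrib_left flip: ennreal_mult)
    qed
  qed
  also have "\<dots> = (\<integral>\<^sup>+x. ennreal ((cmod (h x))\<^sup>2) \<partial>lborel)"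
    by (rule plancherel_bounded_continuous[OF h cont bound])
  finally show "(\<Sum>i\<in>I. \<integral>\<^sup>+x. ennreal ((cmod (conv h (g i) x))\<^sup>2) \<partial>lborel) \<le> (\<integral>\<^sup>+x. ennreal ((cmod (h x))\<^sup>2) \<partial>lborel)" .
qed

section \<open>Extension of the Bessel inequality to all of L^2\<close>

lemma integrable_mult_L2:
  fixes H G :: "'a \<Rightarrow> real"
  assumes [measurable]: "H \<in> borel_measurable M" "G \<in> borel_measurable M"
    and "integrable M (\<lambda>x. (H x)\<^sup>2)" "integrable M (\<lambda>x. (G x)\<^sup>2)"
  shows "integrable M (\<lambda>x. H x * G x)"
proof (rule Bochner_Integration.integrable_bound)
  show "integrable M (\<lambda>x. (H x)\<^sup>2 + (G x)\<^sup>2)" using assms by simp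
  show "AE x in M. norm (H x * G x) \<le> norm ((H x)\<^sup>2 + (G x)\<^sup>2)"
  proof (rule AE_I2)
    fix x
    have "0 \<le> (\<bar>H x\<bar> - \<bar>G x\<bar>)\<^sup>2" by simp
    then have "2 * (\<bar>H x\<bar> * \<bar>G x\<bar>) \<le> (H x)\<^sup>2 + (G x)\<^sup>2"
      by (simp add: power2_diff mult.assoc)
    moreover have "\<bar>H x\<bar> * \<bar>G x\<bar> \<ge> 0" by simp
    ultimately have "\<bar>H x\<bar> * \<bar>G x\<bar> \<le> (H x)\<^sup>2 + (G x)\<^sup>2" by linarith
    then show "norm (H x * G x) \<le> norm ((H x)\<^sup>2 + (G x)\<^sup>2)" by (simp add: abs_mult)
  qed
qed measurable

text \<open>Since \<open>H\<close> and \<open>g i\<close> are square integrable, their shifted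
  product dominates the convolution integrals, so the convolutions converge at every point. Fatou
  then handles the left side and dominated convergence the right side.\<close>

lemma bessel_bound_limit:
  fixes g :: "'i \<Rightarrow> 'a::euclidean_space \<Rightarrow> complex" and H :: "'a \<Rightarrow> real"
  assumes I: "finite I" and g_meas [measurable]: "\<And>i. i \<in> I \<Longrightarrow> g i \<in> borel_measurable borel"
    and g2: "\<And>i. i \<in> I \<Longrightarrow> integrable lborel (\<lambda>x. (cmod (g i x))\<^sup>2)"
    and [measurable]: "\<And>n. k n \<in> borel_measurable borel" "h \<in> borel_measurable borel"
      "H \<in> borel_measurable borel"
    and H2: "integrable lborel (\<lambda>x. (H x)\<^sup>2)"
    and lim: "AE x in lborel. (\<lambda>n. k n x) \<longlonglongrightarrow> h x"
    and le: "\<And>n x. cmod (k n x) \<le> H x"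
    and bd: "\<And>n. bessel_bound I g (k n)"
  shows "bessel_bound I g h"
proof -
  have conv_lim: "(\<lambda>n. conv (k n) (g i) x) \<longlonglongrightarrow> conv h (g i) x" if i: "i \<in> I" for i x
  proof -
    note [measurable] = g_meas[OF i]
    have "(\<lambda>n. LINT y|lborel. k n y * g i (x - y)) \<longlonglongrightarrow> (LINT y|lborel. h y * g i (x - y))"
    proof (rule integral_dominated_convergence)
      show "integrable lborel (\<lambda>y. H y * cmod (g i (x - y)))"
        using integrable_lborel_reflect[OF g2[OF i], of x]
        by (intro integrable_mult_L2 H2) auto
      show "AE y in lborel. (\<lambda>n. k n y * g i (x - y)) \<longlonglongrightarrow> h y * g i (x - y)"
        using lim by eventually_elim (intro tendsto_intros)
      show "AE y in lborel. norm (k n y * g i (x - y)) \<le> H y * cmod (g i (x - y))" for n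
        using le[of n] by (auto simp: norm_mult intro!: mult_right_mono)
    qed measurable
    then show ?thesis by (simp add: conv_lborel)
  qed
  let ?E = "\<lambda>u i x. ennreal ((cmod (conv u (g i) x))\<^sup>2)"
  have k2: "(\<lambda>n. \<integral>\<^sup>+x. ennreal ((cmod (k n x))\<^sup>2) \<partial>lborel) \<longlonglongrightarrow> (\<integral>\<^sup>+x. ennreal ((cmod (h x))\<^sup>2) \<partial>lborel)"
  proof (rule nn_integral_dominated_convergence)
    show "(\<integral>\<^sup>+x. ennreal ((H x)\<^sup>2) \<partial>lborel) < \<infinity>"
      using H2 by (simp add: integrable_iff_bounded)
    show "AE x in lborel. (\<lambda>n. ennreal ((cmod (k n x))\<^sup>2)) \<longlonglongrightarrow> ennreal ((cmod (h x))\<^sup>2)"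
      using lim by eventually_elim (intro tendsto_intros tendsto_ennrealI)
    show "AE x in lborel. ennreal ((cmod (k n x))\<^sup>2) \<le> ennreal ((H x)\<^sup>2)" for n
      using le[of n] by (auto intro!: ennreal_leI power_mono)
  qed measurable
  have "(\<Sum>i\<in>I. \<integral>\<^sup>+x. ?E h i x \<partial>lborel) = (\<integral>\<^sup>+x. (\<Sum>i\<in>I. ?E h i x) \<partial>lborel)"
    by (rule nn_integral_sum[symmetric]) measurable
  also have "\<dots> = (\<integral>\<^sup>+x. liminf (\<lambda>n. \<Sum>i\<in>I. ?E (k n) i x) \<partial>lborel)"
  proof (rule nn_integral_cong)
    fix x
    have "(\<lambda>n. \<Sum>i\<in>I. ?E (k n) i x) \<longlonglongrightarrow> (\<Sum>i\<in>I. ?E h i x)"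
      by (intro tendsto_sum tendsto_ennrealI tendsto_intros conv_lim)
    then show "(\<Sum>i\<in>I. ?E h i x) = liminf (\<lambda>n. \<Sum>i\<in>I. ?E (k n) i x)"
      by (simp add: lim_imp_Liminf)
  qed
  also have "\<dots> \<le> liminf (\<lambda>n. \<integral>\<^sup>+x. (\<Sum>i\<in>I. ?E (k n) i x) \<partial>lborel)"
    by (rule nn_integral_liminf) measurable
  also have "\<dots> \<le> liminf (\<lambda>n. \<integral>\<^sup>+x. ennreal ((cmod (k n x))\<^sup>2) \<partial>lborel)"
  proof (intro Liminf_mono always_eventually allI)
    fix n
    have "(\<integral>\<^sup>+x. (\<Sum>i\<in>I. ?E (k n) i x) \<partial>lborel) = (\<Sum>i\<in>I. \<integral>\<^sup>+x. ?E (k n) i x \<partial>lborel)"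
      by (rule nn_integral_sum) measurable
    then show "(\<integral>\<^sup>+x. (\<Sum>i\<in>I. ?E (k n) i x) \<partial>lborel) \<le> (\<integral>\<^sup>+x. ennreal ((cmod (k n x))\<^sup>2) \<partial>lborel)"
      using bd[of n] by (simp add: bessel_bound_def)
  qed
  also have "\<dots> = (\<integral>\<^sup>+x. ennreal ((cmod (h x))\<^sup>2) \<partial>lborel)"
    by (rule lim_imp_Liminf[OF _ k2]) simp
  finally show ?thesis by (simp add: bessel_bound_def)
qed

text \<open>Measurability already gives continuous functions converging almost everywhere, but with
  no control of size or support. Both are restored by continuous operations that leave the limit
  \<open>h\<close> unchanged.\<close>

lemma continuous_approximation_bounded:
  fixes h :: "'a::euclidean_space \<Rightarrow> complex"
  assumes h [measurable]: "h \<in> borel_measurable borel" and M: "\<And>x. cmod (h x) \<le> M"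
    and R: "\<And>x. norm x > R \<Longrightarrow> h x = 0"
  obtains k where "\<And>n. continuous_on UNIV (k n)"
    "\<And>n x. cmod (k n x) \<le> M * indicator (cball 0 (R + 1)) x"
    "AE x in lborel. (\<lambda>n. k n x) \<longlonglongrightarrow> h x"
proof -
  have M0: "M \<ge> 0" using M[of 0] norm_ge_zero order_trans by blast
  have "h measurable_on UNIV"
    by (rule lebesgue_measurable_imp_measurable_on) (auto intro: measurable_completion)
  then obtain N q where N: "negligible N" and q: "\<And>n. continuous_on UNIV (q n)"
    and q_lim: "\<And>x. x \<notin> N \<Longrightarrow> (\<lambda>n. q n x) \<longlonglongrightarrow> h x"
    by (auto simp: measurable_on_def)
  \<comment> \<open>Projection to the disc that contains all values of \<open>h\<close>: it is
    continuous, since the disc is convex and closed, and fixes these values.\<close>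
  define c where "c = closest_point (cball (0::complex) M)"
  have c_cont: "continuous_on S c" for S
    unfolding c_def using M0 by (intro continuous_on_closest_point) auto
  have c_le: "cmod (c z) \<le> M" for z
    unfolding c_def using closest_point_in_set[of "cball (0::complex) M" z] M0 by auto
  \<comment> \<open>Equal to 1 on the ball of radius \<open>R\<close>, outside which
    \<open>h\<close> vanishes, and equal to 0 outside the ball of radius
    \<open>R + 1\<close>.\<close>
  define cut where "cut x = max 0 (min 1 (R + 1 - norm x))" for x :: 'a
  define k where "k n x = cut x *\<^sub>R c (q n x)" for n x
  show thesis
  proof
    show "continuous_on UNIV (k n)" for n
      unfolding k_def cut_def
      by (intro continuous_intros continuous_on_compose2[OF c_cont q]) auto
    show "cmod (k n x) \<le> M * indicator (cball 0 (R + 1)) x" for n x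
    proof (cases "norm x \<le> R + 1")
      case True
      then have "cut x * cmod (c (q n x)) \<le> 1 * M"
        by (intro mult_mono c_le) (auto simp: cut_def)
      then show ?thesis using True by (simp add: k_def cut_def)
    qed (simp add: k_def cut_def)
    have "AE x in lebesgue. x \<notin> N"
      using N by (simp add: negligible_iff_null_sets AE_not_in)
    then have "AE x in lborel. x \<notin> N" by (simp add: AE_completion_iff)
    then show "AE x in lborel. (\<lambda>n. k n x) \<longlonglongrightarrow> h x"
    proof eventually_elim
      fix x assume "x \<notin> N"
      have "(\<lambda>n. c (q n x)) \<longlonglongrightarrow> c (h x)"
        using c_cont[of UNIV] q_lim[OF \<open>x \<notin> N\<close>]
        by (intro isCont_tendsto_compose[of "h x" c]) (auto simp: continuous_on_eq_continuous_at)
      also have "c (h x) = h x" unfolding c_def using M by (intro closest_point_self) auto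
      finally have "(\<lambda>n. k n x) \<longlonglongrightarrow> cut x *\<^sub>R h x" unfolding k_def by (intro tendsto_intros)
      also have "cut x *\<^sub>R h x = h x"
        using R[of x] by (cases "norm x > R") (auto simp: cut_def)
      finally show "(\<lambda>n. k n x) \<longlonglongrightarrow> h x" .
    qed
  qed
qed

text \<open>Two passages to the limit: from continuous functions to bounded functions of bounded
  support, and from these to L^2 by truncation.\<close>

lemma bessel_bound_borel:
  fixes g :: "'i \<Rightarrow> 'a::euclidean_space \<Rightarrow> complex"
  assumes I: "finite I" and g: "\<And>i. i \<in> I \<Longrightarrow> integrable lborel (g i)"
    and g2: "\<And>i. i \<in> I \<Longrightarrow> integrable lborel (\<lambda>x. (cmod (g i x))\<^sup>2)"
    and bessel: "AE \<xi> in lborel. (\<Sum>i\<in>I. (cmod (fourier (g i) \<xi>))\<^sup>2) \<le> 1"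
    and h [measurable]: "h \<in> borel_measurable borel" and h2: "integrable lborel (\<lambda>x. (cmod (h x))\<^sup>2)"
  shows "bessel_bound I g h"
proof -
  have g_meas: "g i \<in> borel_measurable borel" if "i \<in> I" for i using g[OF that] by auto
  have *: "bessel_bound I g u"
    if u [measurable]: "u \<in> borel_measurable borel" and M: "\<And>x. cmod (u x) \<le> M"
      and R: "\<And>x. norm x > R \<Longrightarrow> u x = 0" for u M R
  proof -
    obtain k where k: "\<And>n. continuous_on UNIV (k n)"
      "\<And>n x. cmod (k n x) \<le> M * indicator (cball 0 (R + 1)) x"
      "AE x in lborel. (\<lambda>n. k n x) \<longlonglongrightarrow> u x"
      using continuous_approximation_bounded[OF u M R] by blast
    let ?H = "\<lambda>x::'a. M * indicator (cball 0 (R + 1)) x"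
    have M0: "M \<ge> 0" using M[of 0] norm_ge_zero order_trans by blast
    have fin: "emeasure lborel (cball (0::'a) (R + 1)) < \<infinity>"
      by (rule emeasure_compact_finite) simp
    have H: "integrable lborel ?H"
      using fin by (intro integrable_mult_right integrable_real_indicator) auto
    have H_meas: "?H \<in> borel_measurable borel"
      by (intro borel_measurable_times borel_measurable_const borel_measurable_indicator) simp
    have H2: "integrable lborel (\<lambda>x. (?H x)\<^sup>2)"
    proof -
      have "(\<lambda>x. (?H x)\<^sup>2) = (\<lambda>x. M * ?H x)"
        by (auto simp: fun_eq_iff power2_eq_square indicator_def)
      then show ?thesis using H by (simp only: integrable_mult_right)
    qed
    have k_meas [measurable]: "k n \<in> borel_measurable borel" for n
      by (rule borel_measurable_continuous_onI[OF k(1)])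
    have k_int: "integrable lborel (k n)" for n
    proof (rule Bochner_Integration.integrable_bound[OF H])
      show "k n \<in> borel_measurable lborel" by measurable
      show "AE x in lborel. norm (k n x) \<le> norm (?H x)"
      proof (rule AE_I2)
        fix x show "norm (k n x) \<le> norm (?H x)" unfolding real_norm_def by (rule order_trans[OF k(2) abs_ge_self])
      qed
    qed
    have k_le: "cmod (k n x) \<le> M" for n x
    proof -
      have "?H x \<le> M" using M0 by (simp add: indicator_def)
      with k(2)[of n x] show ?thesis by linarith
    qed
    show ?thesis
    proof (rule bessel_bound_limit[OF I g_meas g2 k_meas u H_meas H2 k(3) k(2)])
      show "bessel_bound I g (k n)" for n
        by (rule bessel_bound_continuous[OF I g bessel k(1) k_le k_int])
    qed
  qed
  \<comment> \<open>Truncation in both argument and value. At each point it equals \<open>h\<close>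
    from some n on, and the modulus of \<open>h\<close> dominates it throughout.\<close>
  define v where "v n x = (if norm x \<le> real n \<and> cmod (h x) \<le> real n then h x else 0)" for n x
  have v_meas [measurable]: "v n \<in> borel_measurable borel" for n
    unfolding v_def by measurable
  show ?thesis
  proof (rule bessel_bound_limit[OF I g_meas g2 v_meas h _ h2])
    show "AE x in lborel. (\<lambda>n. v n x) \<longlonglongrightarrow> h x"
    proof (rule AE_I2, rule tendsto_eventually)
      fix x
      obtain m :: nat where m: "max (norm x) (cmod (h x)) \<le> real m" using real_arch_simple by blast
      show "\<forall>\<^sub>F n in sequentially. v n x = h x"
        using eventually_ge_at_top[of m] by eventually_elim (use m in \<open>auto simp: v_def\<close>)
    qed
    show "bessel_bound I g (v n)" for n
      by (rule *[of _ "real n" "real n"]) (auto simp: v_def)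
  qed (auto simp: v_def)
qed

section \<open>Borel representatives and behaviour under translation\<close>

lemma borel_representative_complex:
  fixes g :: "'a::euclidean_space \<Rightarrow> complex"
  assumes "g \<in> borel_measurable lebesgue"
  obtains g' where "g' \<in> borel_measurable borel" "AE x in lborel. g x = g' x"
proof -
  have "(\<lambda>x. Re (g x)) \<in> borel_measurable lebesgue" "(\<lambda>x. Im (g x)) \<in> borel_measurable lebesgue"
    using assms by measurable
  then obtain a b where ab: "a \<in> borel_measurable borel" "AE x in lborel. Re (g x) = a x"
     "b \<in> borel_measurable borel" "AE x in lborel. Im (g x) = b x"
    using completion_ex_borel_measurable_real[of "\<lambda>x. Re (g x)" lborel]
      completion_ex_borel_measurable_real[of "\<lambda>x. Im (g x)" lborel] by auto
  show thesis
  proof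
    show "(\<lambda>x. complex_of_real (a x) + \<i> * complex_of_real (b x)) \<in> borel_measurable borel"
      using ab(1,3) by measurable
    show "AE x in lborel. g x = complex_of_real (a x) + \<i> * complex_of_real (b x)"
      using ab(2,4) by eventually_elim (simp add: complex_eq_iff)
  qed
qed

text \<open>Measurability of \<open>f\<close> comes from the completeness of Lebesgue
  measure.\<close>

lemma integral_lebesgue_cong:
  fixes f g :: "'a::euclidean_space \<Rightarrow> complex"
  assumes eq: "AE x in lborel. f x = g x" and g: "g \<in> borel_measurable borel"
  shows "(LINT x|lebesgue. f x) = (LINT x|lebesgue. g x)"
proof -
  have eq': "AE x in lebesgue. g x = f x" using AE_completion[OF eq] by eventually_elim simp
  have g': "g \<in> borel_measurable lebesgue" using g by (simp add: measurable_completion)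
  have "f \<in> borel_measurable lebesgue"
    by (rule borel_measurable_AE[OF g' eq'])
  then show ?thesis using eq' g' by (intro integral_cong_AE) auto
qed

lemma AE_lborel_reflect:
  fixes x :: "'a::euclidean_space"
  assumes "AE y in lborel. P y"
  shows "AE y in lborel. P (x - y)"
proof -
  obtain N where N: "N \<in> null_sets lborel" "{y \<in> space lborel. \<not> P y} \<subseteq> N"
    using assms by (auto simp: eventually_ae_filter)
  have [measurable]: "N \<in> sets borel" using N(1) by auto
  have "(\<integral>\<^sup>+y. indicator N (x - y) \<partial>lborel) = 0"
    using nn_integral_lborel_reflect[of "indicator N" x] N(1) by (simp add: null_sets_def)
  then have "AE y in lborel. x - y \<notin> N"
    by (subst (asm) nn_integral_0_iff_AE) (auto simp: indicator_def)
  then show ?thesis by eventually_elim (use N(2) in auto)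
qed

lemma AE_lborel_translate:
  fixes c :: "'a::euclidean_space"
  assumes "AE y in lborel. P y"
  shows "AE y in lborel. P (y - c)"
  using AE_lborel_reflect[OF AE_lborel_reflect[OF assms, of 0], of c] by simp

text \<open>The integrands differ on a null set, so the convolutions agree at every point and not
  merely almost everywhere.\<close>

lemma conv_cong_AE:
  assumes "AE y in lborel. h y = h' y" and g: "AE y in lborel. g y = g' y"
    and [measurable]: "h' \<in> borel_measurable borel" "g' \<in> borel_measurable borel"
  shows "conv h g x = conv h' g' x"
  unfolding conv_def
proof (rule integral_lebesgue_cong)
  show "AE y in lborel. h y * g (x - y) = h' y * g' (x - y)"
    using assms(1) AE_lborel_reflect[OF g, of x] by eventually_elim simp
qed measurable

lemma fourier_cong_AE:
  assumes "AE y in lborel. g y = g' y" and [measurable]: "g' \<in> borel_measurable borel"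
  shows "fourier g = fourier g'"
  unfolding fourier_def
proof (rule ext, rule integral_lebesgue_cong)
  fix \<xi>
  show "AE x in lborel. g x * exp (- 2 * complex_of_real pi * \<i> * complex_of_real (x \<bullet> \<xi>)) =
      g' x * exp (- 2 * complex_of_real pi * \<i> * complex_of_real (x \<bullet> \<xi>))"
    using assms(1) by eventually_elim simp
qed measurable

lemma borel_measurable_translate [measurable]:
  fixes h :: "'a::euclidean_space \<Rightarrow> complex"
  assumes [measurable]: "h \<in> borel_measurable borel"
  shows "translate c h \<in> borel_measurable borel"
  unfolding translate_def[abs_def] by measurable

text \<open>The two equations together move a translation from one factor to the other, which is how
  the shift of \<open>f\<close> reaches the output function.\<close>

lemma conv_translate:
  fixes h g :: "'a::euclidean_space \<Rightarrow> complex"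
  assumes [measurable]: "h \<in> borel_measurable borel" "g \<in> borel_measurable borel"
  shows "conv (translate c h) g = translate c (conv h g)"
    and "conv h (translate c g) = translate c (conv h g)"
proof -
  show "conv (translate c h) g = translate c (conv h g)"
  proof
    fix x
    have "conv (translate c h) g x = (LINT y|lborel. h (y - c) * g (x - y))"
      by (simp add: conv_lborel) (simp add: translate_def)
    also have "\<dots> = (LINT y|lborel. h y * g (x - c - y))"
      using integral_lborel_affine[of "\<lambda>y. h (y - c) * g (x - y)" 1 c]
      by (simp add: diff_diff_eq)
    finally show "conv (translate c h) g x = translate c (conv h g) x"
      by (simp add: translate_def conv_lborel)
  qed
  show "conv h (translate c g) = translate c (conv h g)"
    by (auto simp: fun_eq_iff translate_def conv_def algebra_simps)
qed

subsection \<open>Energy of the scattering transform\<close>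

text \<open>Measurability and translation are handled from the last index of a path, but the energy
  estimate splits off the first one: the remaining path then acts on a new input function.\<close>

lemma propagator_Cons:
  "propagator g (l # p) f = propagator g p (\<lambda>x. complex_of_real (cmod (conv f (g l) x)))"
  by (simp add: propagator_def)

lemma integrable_norm_square_conv:
  fixes f g :: "'a::euclidean_space \<Rightarrow> complex"
  assumes g: "integrable lborel g" and g2: "integrable lborel (\<lambda>x. (cmod (g x))\<^sup>2)"
    and le: "AE \<xi> in lborel. (cmod (fourier g \<xi>))\<^sup>2 \<le> 1"
    and f [measurable]: "f \<in> borel_measurable borel" and f2: "integrable lborel (\<lambda>x. (cmod (f x))\<^sup>2)"
  shows "integrable lborel (\<lambda>x. (cmod (conv f g x))\<^sup>2)"
proof -
  have [measurable]: "g \<in> borel_measurable borel" using g by auto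
  have "bessel_bound {()} (\<lambda>_. g) f"
    by (rule bessel_bound_borel) (use g g2 le f f2 in simp_all)
  then have "(\<integral>\<^sup>+x. ennreal ((cmod (conv f g x))\<^sup>2) \<partial>lborel) \<le> (\<integral>\<^sup>+x. ennreal ((cmod (f x))\<^sup>2) \<partial>lborel)"
    by (simp add: bessel_bound_def)
  also have "\<dots> < \<infinity>" using f2 by (simp add: integrable_iff_bounded)
  finally show ?thesis by (simp add: integrable_iff_bounded)
qed

lemma borel_measurable_propagator:
  fixes f :: "'a::euclidean_space \<Rightarrow> complex"
  assumes "f \<in> borel_measurable borel" "\<And>l. l \<in> set p \<Longrightarrow> g l \<in> borel_measurable borel"
  shows "propagator g p f \<in> borel_measurable borel"
  using assms
proof (induction p rule: rev_induct)
  case (snoc l p)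
  then have [measurable]: "propagator g p f \<in> borel_measurable borel" "g l \<in> borel_measurable borel"
    by auto
  show ?case unfolding propagator_snoc by measurable
qed (simp add: propagator_Nil)

lemma propagator_translate:
  fixes f :: "'a::euclidean_space \<Rightarrow> complex"
  assumes "f \<in> borel_measurable borel" "\<And>l. l \<in> set p \<Longrightarrow> g l \<in> borel_measurable borel"
  shows "propagator g p (translate c f) = translate c (propagator g p f)"
  using assms(2)
proof (induction p rule: rev_induct)
  case (snoc l p)
  then have "propagator g p f \<in> borel_measurable borel" "g l \<in> borel_measurable borel"
    using assms(1) by (auto intro: borel_measurable_propagator)
  with snoc show ?case
    by (simp add: propagator_snoc conv_translate) (auto simp: translate_def fun_eq_iff)
qed (simp add: propagator_Nil)

text \<open>Only the empty path leaves an exceptional set; after one convolution the functions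
  coincide everywhere.\<close>

lemma propagator_cong_AE:
  fixes f :: "'a::euclidean_space \<Rightarrow> complex"
  assumes f: "AE x in lborel. f x = f' x" "f' \<in> borel_measurable borel"
    and g: "\<And>l. l \<in> set p \<Longrightarrow> AE x in lborel. g l x = g' l x"
      "\<And>l. l \<in> set p \<Longrightarrow> g' l \<in> borel_measurable borel"
  shows "AE x in lborel. propagator g p f x = propagator g' p f' x"
  using g
proof (induction p rule: rev_induct)
  case (snoc l p)
  have "conv (propagator g p f) (g l) x = conv (propagator g' p f') (g' l) x" for x
    using snoc f(2) by (intro conv_cong_AE borel_measurable_propagator) auto
  then show ?case by (simp add: propagator_snoc)
qed (simp add: propagator_Nil f(1))

lemma integrable_norm_square_propagator:
  fixes f :: "'a::euclidean_space \<Rightarrow> complex"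
  assumes "\<And>l. l \<in> set p \<Longrightarrow> integrable lborel (g l)"
    and "\<And>l. l \<in> set p \<Longrightarrow> integrable lborel (\<lambda>x. (cmod (g l x))\<^sup>2)"
    and "\<And>l. l \<in> set p \<Longrightarrow> AE \<xi> in lborel. (cmod (fourier (g l) \<xi>))\<^sup>2 \<le> 1"
    and f: "f \<in> borel_measurable borel" "integrable lborel (\<lambda>x. (cmod (f x))\<^sup>2)"
  shows "integrable lborel (\<lambda>x. (cmod (propagator g p f x))\<^sup>2)"
  using assms(1-3)
proof (induction p rule: rev_induct)
  case (snoc l p)
  have "propagator g p f \<in> borel_measurable borel"
    using snoc.prems(1) f(1) by (intro borel_measurable_propagator) auto
  then have "integrable lborel (\<lambda>x. (cmod (conv (propagator g p f) (g l) x))\<^sup>2)"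
    using snoc by (intro integrable_norm_square_conv) auto
  then show ?case by (simp add: propagator_snoc)
qed (simp add: propagator_Nil f)

text \<open>The Bessel inequality splits the energy of an input into that of its output, which is
  the entry of the empty path, and those of the inputs of the next layer. Taking the modulus does
  not change the energy, so the bound follows by induction on the length, with \<open>f\<close>
  arbitrary. The output function \<open>\<phi>\<close> is kept apart from the family
  \<open>g\<close> so that it can be replaced later.\<close>

lemma scattering_energy:
  fixes g :: "'i \<Rightarrow> 'a::euclidean_space \<Rightarrow> complex"
  assumes L: "finite L" and g: "\<And>i. i \<in> L \<Longrightarrow> integrable lborel (g i)"
    and g2: "\<And>i. i \<in> L \<Longrightarrow> integrable lborel (\<lambda>x. (cmod (g i x))\<^sup>2)"
    and \<phi>: "integrable lborel \<phi>" "integrable lborel (\<lambda>x. (cmod (\<phi> x))\<^sup>2)"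
    and bessel: "AE \<xi> in lborel. (cmod (fourier \<phi> \<xi>))\<^sup>2 + (\<Sum>i\<in>L. (cmod (fourier (g i) \<xi>))\<^sup>2) \<le> 1"
    and f: "f \<in> borel_measurable borel" "integrable lborel (\<lambda>x. (cmod (f x))\<^sup>2)"
  shows "(\<Sum>p | set p \<subseteq> L \<and> length p \<le> n. \<integral>\<^sup>+x. ennreal ((cmod (conv (propagator g p f) \<phi> x))\<^sup>2) \<partial>lborel)
    \<le> (\<integral>\<^sup>+x. ennreal ((cmod (f x))\<^sup>2) \<partial>lborel)"
proof -
  \<comment> \<open>\<open>None\<close> indexes the output function, so it cannot clash with an
    index in \<open>L\<close>.\<close>
  define G where "G = case_option \<phi> g"
  have step: "(\<integral>\<^sup>+x. ennreal ((cmod (conv f \<phi> x))\<^sup>2) \<partial>lborel) +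
     (\<Sum>l\<in>L. \<integral>\<^sup>+x. ennreal ((cmod (conv f (g l) x))\<^sup>2) \<partial>lborel) \<le> (\<integral>\<^sup>+x. ennreal ((cmod (f x))\<^sup>2) \<partial>lborel)"
    if "f \<in> borel_measurable borel" "integrable lborel (\<lambda>x. (cmod (f x))\<^sup>2)" for f
  proof -
    have "bessel_bound (insert None (Some ` L)) G f"
    proof (rule bessel_bound_borel)
      show "AE \<xi> in lborel. (\<Sum>i\<in>insert None (Some ` L). (cmod (fourier (G i) \<xi>))\<^sup>2) \<le> 1"
        using bessel L by (simp add: sum.reindex G_def)
    qed (use that L g g2 \<phi> in \<open>auto simp: G_def\<close>)
    then show ?thesis using L by (simp add: bessel_bound_def G_def sum.reindex)
  qed
  have le1: "AE \<xi> in lborel. (cmod (fourier (g l) \<xi>))\<^sup>2 \<le> 1" if l: "l \<in> L" for l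
    using bessel
  proof eventually_elim
    fix \<xi> assume "(cmod (fourier \<phi> \<xi>))\<^sup>2 + (\<Sum>i\<in>L. (cmod (fourier (g i) \<xi>))\<^sup>2) \<le> 1"
    moreover have "(cmod (fourier (g l) \<xi>))\<^sup>2 \<le> (\<Sum>i\<in>L. (cmod (fourier (g i) \<xi>))\<^sup>2)"
      using l L by (intro member_le_sum) auto
    ultimately show "(cmod (fourier (g l) \<xi>))\<^sup>2 \<le> 1"
      using zero_le_power2[of "cmod (fourier \<phi> \<xi>)"] by linarith
  qed
  let ?S = "\<lambda>n. {p. set p \<subseteq> L \<and> length p \<le> n}"
  let ?E = "\<lambda>h. \<integral>\<^sup>+x. ennreal ((cmod (h x))\<^sup>2) \<partial>lborel"
  show ?thesis using f
  proof (induction n arbitrary: f)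
    case 0
    have "?S 0 = {[]}" by auto
    then have "(\<Sum>p\<in>?S 0. ?E (conv (propagator g p f) \<phi>)) = ?E (conv f \<phi>)"
      by (simp add: propagator_Nil)
    also have "\<dots> \<le> ?E f" using step[OF 0] by (meson le_add1 order_trans add_increasing2 order_refl zero_le)
    finally show ?case .
  next
    case (Suc n)
    have S: "?S (Suc n) = insert [] ((\<lambda>(l, p). l # p) ` (L \<times> ?S n))"
    proof (intro set_eqI iffI)
      fix p assume "p \<in> ?S (Suc n)"
      then show "p \<in> insert [] ((\<lambda>(l, p). l # p) ` (L \<times> ?S n))"
        by (cases p) (auto simp: image_iff)
    qed auto
    have fin: "finite (?S n)" using L by (rule finite_lists_length_le)
    have inj: "inj_on (\<lambda>(l, p). l # p) (L \<times> ?S n)" by (auto simp: inj_on_def)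
    have first: "(\<Sum>p\<in>?S n. ?E (conv (propagator g (l # p) f) \<phi>)) \<le> ?E (conv f (g l))"
      if l: "l \<in> L" for l
    proof -
      \<comment> \<open>The input seen by all paths beginning with \<open>l\<close>; the induction
        hypothesis is applied to it, with paths one shorter.\<close>
      let ?u = "\<lambda>x. complex_of_real (cmod (conv f (g l) x))"
      have "integrable lborel (\<lambda>x. (cmod (conv f (g l) x))\<^sup>2)"
        using l by (intro integrable_norm_square_conv g g2 le1 Suc.prems)
      moreover have "conv f (g l) \<in> borel_measurable borel"
        using g[OF l] Suc.prems(1) by (intro borel_measurable_conv) auto
      ultimately have "(\<Sum>p\<in>?S n. ?E (conv (propagator g p ?u) \<phi>)) \<le> ?E ?u"
        by (intro Suc.IH) auto
      then show ?thesis by (simp add: propagator_Cons)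
    qed
    have "(\<Sum>p\<in>?S (Suc n). ?E (conv (propagator g p f) \<phi>)) =
       ?E (conv f \<phi>) + (\<Sum>p\<in>(\<lambda>(l, p). l # p) ` (L \<times> ?S n). ?E (conv (propagator g p f) \<phi>))"
      unfolding S using L fin by (subst sum.insert) (auto simp: propagator_Nil)
    also have "(\<Sum>p\<in>(\<lambda>(l, p). l # p) ` (L \<times> ?S n). ?E (conv (propagator g p f) \<phi>)) =
        (\<Sum>l\<in>L. \<Sum>p\<in>?S n. ?E (conv (propagator g (l # p) f) \<phi>))"
      by (subst sum.reindex[OF inj]) (simp add: sum.cartesian_product case_prod_unfold)
    also have "?E (conv f \<phi>) + \<dots> \<le> ?E (conv f \<phi>) + (\<Sum>l\<in>L. ?E (conv f (g l)))"
      by (intro add_left_mono sum_mono first)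
    also have "\<dots> \<le> ?E f" by (rule step[OF Suc.prems])
    finally show ?case .
  qed
qed

section \<open>Replacing the output function by its scaled translation difference\<close>

lemma fourier_translate:
  fixes g :: "'a::euclidean_space \<Rightarrow> complex"
  assumes [measurable]: "g \<in> borel_measurable borel"
  shows "fourier (translate c g) \<xi> = cis (- (2 * pi * (c \<bullet> \<xi>))) * fourier g \<xi>"
proof -
  have "fourier (translate c g) \<xi> = (LINT x|lborel. g (x - c) * cis (- (2 * pi * (x \<bullet> \<xi>))))"
    by (simp add: fourier_lborel) (simp add: translate_def)
  also have "\<dots> = (LINT x|lborel. g x * cis (- (2 * pi * ((c + x) \<bullet> \<xi>))))"
    using integral_lborel_affine[of "\<lambda>x. g (x - c) * cis (- (2 * pi * (x \<bullet> \<xi>)))" 1 c] by simp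
  also have "\<dots> = (LINT x|lborel. cis (- (2 * pi * (c \<bullet> \<xi>))) * (g x * cis (- (2 * pi * (x \<bullet> \<xi>)))))"
    by (simp add: inner_add_left cis_mult algebra_simps)
  finally show ?thesis by (simp add: fourier_lborel)
qed

text \<open>A chord of the unit circle is no longer than its arc; formally this is the Taylor
  estimate of order zero.\<close>

lemma cmod_one_minus_cis_le: "cmod (1 - cis t) \<le> \<bar>t\<bar>"
  using iexp_approx1[of t 0] by (simp add: cis_conv_exp norm_minus_commute)

text \<open>Each entry of the difference is \<epsilon> times the entry of a transform whose output
  function is \<open>\<phi>\<close>. The energy bound for that transform therefore yields the factor
  \<open>\<epsilon>\<^sup>2\<close>.\<close>

lemma scattering_translate_energy:
  fixes g :: "'i::zero \<Rightarrow> 'a::euclidean_space \<Rightarrow> complex"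
  assumes P: "finite P" "P \<subseteq> lists L" and L: "finite L" "0 \<notin> L"
    and g: "\<And>i. i \<in> insert 0 L \<Longrightarrow> integrable lborel (g i)"
    and g2: "\<And>i. i \<in> insert 0 L \<Longrightarrow> integrable lborel (\<lambda>x. (cmod (g i x))\<^sup>2)"
    and bessel: "AE \<xi> in lborel. (\<Sum>i\<in>insert 0 L. (cmod (fourier (g i) \<xi>))\<^sup>2) \<le> 1"
    and \<epsilon>: "\<epsilon> > 0" "\<And>\<xi>. fourier (g 0) \<xi> \<noteq> 0 \<Longrightarrow> 2 * pi * (norm c * norm \<xi>) \<le> \<epsilon>"
    and f: "f \<in> borel_measurable borel" "integrable lborel (\<lambda>x. (cmod (f x))\<^sup>2)"
  shows "(\<Sum>p\<in>P. \<integral>\<^sup>+x. ennreal ((cmod (scattering g f p x - scattering g (translate c f) p x))\<^sup>2) \<partial>lborel)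
    \<le> ennreal (\<epsilon>\<^sup>2) * (\<integral>\<^sup>+x. ennreal ((cmod (f x))\<^sup>2) \<partial>lborel)"
proof -
  have g_meas [measurable]: "g i \<in> borel_measurable borel" if "i \<in> insert 0 L" for i
    using g[OF that] by auto
  have [measurable]: "g 0 \<in> borel_measurable borel" by (rule g_meas) simp
  \<comment> \<open>Dividing by \<epsilon> is exactly what makes the transform of
    \<open>\<phi>\<close> no larger in modulus than that of \<open>g 0\<close>, so that
    \<open>\<phi>\<close> may take its place in the Bessel condition.\<close>
  define \<phi> where "\<phi> = (\<lambda>x. (g 0 x - translate c (g 0) x) / complex_of_real \<epsilon>)"
  have g0: "integrable lborel (translate c (g 0))" "integrable lborel (\<lambda>x. (cmod (translate c (g 0) x))\<^sup>2)"
    using integrable_lborel_translate[OF g[of 0], of c] integrable_lborel_translate[OF g2[of 0], of c]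
    by (simp_all add: translate_def[abs_def])
  have \<phi>: "integrable lborel \<phi>" "integrable lborel (\<lambda>x. (cmod (\<phi> x))\<^sup>2)"
  proof -
    show "integrable lborel \<phi>" using g[of 0] g0(1) by (simp add: \<phi>_def)
    have "integrable lborel (\<lambda>x. (cmod (g 0 x - translate c (g 0) x))\<^sup>2)"
    proof (rule Bochner_Integration.integrable_bound)
      show "integrable lborel (\<lambda>x. 2 * (cmod (g 0 x))\<^sup>2 + 2 * (cmod (translate c (g 0) x))\<^sup>2)"
        using g2[of 0] g0(2) by simp
      show "AE x in lborel. norm ((cmod (g 0 x - translate c (g 0) x))\<^sup>2) \<le>
          norm (2 * (cmod (g 0 x))\<^sup>2 + 2 * (cmod (translate c (g 0) x))\<^sup>2)"
      proof (rule AE_I2)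
        fix x
        let ?a = "cmod (g 0 x)" and ?b = "cmod (translate c (g 0) x)"
        have "(cmod (g 0 x - translate c (g 0) x))\<^sup>2 \<le> (?a + ?b)\<^sup>2"
          by (intro power_mono norm_triangle_ineq4) simp
        also have "\<dots> \<le> 2 * ?a\<^sup>2 + 2 * ?b\<^sup>2"
          using sum_squares_ge_zero[of "?a - ?b" 0] by (simp add: power2_eq_square algebra_simps)
        finally show "norm ((cmod (g 0 x - translate c (g 0) x))\<^sup>2) \<le> norm (2 * ?a\<^sup>2 + 2 * ?b\<^sup>2)"
          by simp
      qed
    qed measurable
    then show "integrable lborel (\<lambda>x. (cmod (\<phi> x))\<^sup>2)"
      by (simp add: \<phi>_def norm_divide power_divide)
  qed
  have [measurable]: "\<phi> \<in> borel_measurable borel" using \<phi> by auto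
  have fourier_\<phi>: "cmod (fourier \<phi> \<xi>) \<le> cmod (fourier (g 0) \<xi>)" for \<xi>
  proof -
    have "fourier \<phi> \<xi> = (LINT x|lborel. (g 0 x * cis (- (2 * pi * (x \<bullet> \<xi>))) -
        translate c (g 0) x * cis (- (2 * pi * (x \<bullet> \<xi>)))) / complex_of_real \<epsilon>)"
      by (simp add: fourier_lborel[of \<phi>]) (simp add: \<phi>_def left_diff_distrib)
    also have "\<dots> = (fourier (g 0) \<xi> - fourier (translate c (g 0)) \<xi>) / complex_of_real \<epsilon>"
      using g[of 0] g0(1) by (simp add: fourier_lborel integrable_mult_cis)
    also have "\<dots> = fourier (g 0) \<xi> * ((1 - cis (- (2 * pi * (c \<bullet> \<xi>)))) / complex_of_real \<epsilon>)"
      by (simp add: fourier_translate algebra_simps)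
    finally have eq: "fourier \<phi> \<xi> = fourier (g 0) \<xi> * ((1 - cis (- (2 * pi * (c \<bullet> \<xi>)))) / complex_of_real \<epsilon>)" .
    \<comment> \<open>The bound on the norm of \<xi> is available only on the support of
      \<open>fourier (g 0)\<close>; off it both sides vanish.\<close>
    show ?thesis
    proof (cases "fourier (g 0) \<xi> = 0")
      case False
      have "cmod (1 - cis (- (2 * pi * (c \<bullet> \<xi>)))) \<le> 2 * pi * \<bar>c \<bullet> \<xi>\<bar>"
        using cmod_one_minus_cis_le[of "- (2 * pi * (c \<bullet> \<xi>))"] by (simp add: abs_mult)
      also have "\<dots> \<le> 2 * pi * (norm c * norm \<xi>)"
        by (intro mult_left_mono Cauchy_Schwarz_ineq2) simp
      also have "\<dots> \<le> \<epsilon>" by (rule \<epsilon>(2)[OF False])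
      finally have "cmod ((1 - cis (- (2 * pi * (c \<bullet> \<xi>)))) / complex_of_real \<epsilon>) \<le> 1"
        using \<epsilon>(1) by (simp add: norm_divide)
      then show ?thesis unfolding eq norm_mult by (intro mult_left_le) auto
    qed (simp add: eq)
  qed
  have le1: "AE \<xi> in lborel. (cmod (fourier (g l) \<xi>))\<^sup>2 \<le> 1" if l: "l \<in> L" for l
    using bessel
  proof eventually_elim
    fix \<xi> assume "(\<Sum>i\<in>insert 0 L. (cmod (fourier (g i) \<xi>))\<^sup>2) \<le> 1"
    moreover have "(cmod (fourier (g l) \<xi>))\<^sup>2 \<le> (\<Sum>i\<in>insert 0 L. (cmod (fourier (g i) \<xi>))\<^sup>2)"
      using l L by (intro member_le_sum) auto
    ultimately show "(cmod (fourier (g l) \<xi>))\<^sup>2 \<le> 1" by linarith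
  qed
  have entry: "scattering g f p x - scattering g (translate c f) p x =
     complex_of_real \<epsilon> * conv (propagator g p f) \<phi> x" if p: "p \<in> P" for p x
  proof -
    let ?u = "propagator g p f"
    have set_p: "set p \<subseteq> L" using p P(2) by auto
    have u [measurable]: "?u \<in> borel_measurable borel"
      using set_p by (intro borel_measurable_propagator f g_meas) auto
    have u2: "integrable lborel (\<lambda>x. (cmod (?u x))\<^sup>2)"
      using set_p by (intro integrable_norm_square_propagator f g g2 le1) auto
    \<comment> \<open>Needed at every x in order to split the convolution with a difference into a
      difference of convolutions.\<close>
    have int: "integrable lborel (\<lambda>y. ?u y * k (x - y))"
      if "k \<in> borel_measurable borel" "integrable lborel (\<lambda>x. (cmod (k x))\<^sup>2)" for k :: "'a \<Rightarrow> complex"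
    proof -
      have [measurable]: "k \<in> borel_measurable borel" by fact
      have "integrable lborel (\<lambda>y. cmod (?u y) * cmod (k (x - y)))"
        using integrable_lborel_reflect[OF that(2), of x] u2 by (intro integrable_mult_L2) auto
      then have "integrable lborel (\<lambda>y. norm (?u y * k (x - y)))" by (simp add: norm_mult)
      then show ?thesis by (rule integrable_norm_cancel) measurable
    qed
    have "conv ?u \<phi> x = (LINT y|lborel. (?u y * g 0 (x - y) - ?u y * translate c (g 0) (x - y)) / complex_of_real \<epsilon>)"
      by (simp add: conv_lborel[of _ \<phi>]) (simp add: \<phi>_def right_diff_distrib)
    also have "\<dots> = (conv ?u (g 0) x - conv ?u (translate c (g 0)) x) / complex_of_real \<epsilon>"
      using int[of "g 0"] int[of "translate c (g 0)"] g2[of 0] g0(2) by (simp add: conv_lborel)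
    also have "conv ?u (translate c (g 0)) = conv (propagator g p (translate c f)) (g 0)"
      using set_p f(1) g_meas by (subst propagator_translate) (auto simp: conv_translate)
    finally show ?thesis using \<epsilon>(1) by (simp add: scattering_def)
  qed
  \<comment> \<open>A finite set of paths has a longest member, so it embeds into the set of paths
    of bounded length for which the energy bound is stated.\<close>
  obtain n where n: "\<And>p. p \<in> P \<Longrightarrow> length p \<le> n"
    using P(1) by (metis finite_imageI finite_nat_set_iff_bounded_le imageI)
  let ?E = "\<lambda>h. \<integral>\<^sup>+x. ennreal ((cmod (h x))\<^sup>2) \<partial>lborel"
  have "(\<Sum>p\<in>P. \<integral>\<^sup>+x. ennreal ((cmod (scattering g f p x - scattering g (translate c f) p x))\<^sup>2) \<partial>lborel)
     = (\<Sum>p\<in>P. ennreal (\<epsilon>\<^sup>2) * ?E (conv (propagator g p f) \<phi>))"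
  proof (intro sum.cong refl)
    fix p assume p: "p \<in> P"
    have [measurable]: "propagator g p f \<in> borel_measurable borel"
      using p P by (intro borel_measurable_propagator f g_meas) auto
    show "(\<integral>\<^sup>+x. ennreal ((cmod (scattering g f p x - scattering g (translate c f) p x))\<^sup>2) \<partial>lborel)
        = ennreal (\<epsilon>\<^sup>2) * ?E (conv (propagator g p f) \<phi>)"
      by (subst nn_integral_cmult[symmetric])
         (auto simp: entry[OF p] norm_mult power_mult_distrib ennreal_mult)
  qed
  also have "\<dots> = ennreal (\<epsilon>\<^sup>2) * (\<Sum>p\<in>P. ?E (conv (propagator g p f) \<phi>))"
    by (simp add: sum_distrib_left)
  also have "(\<Sum>p\<in>P. ?E (conv (propagator g p f) \<phi>)) \<le>
      (\<Sum>p | set p \<subseteq> L \<and> length p \<le> n. ?E (conv (propagator g p f) \<phi>))"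
    using P n by (intro sum_mono2 finite_lists_length_le L) auto
  also have "\<dots> \<le> ?E f"
  proof (intro scattering_energy)
    show "AE \<xi> in lborel. (cmod (fourier \<phi> \<xi>))\<^sup>2 + (\<Sum>i\<in>L. (cmod (fourier (g i) \<xi>))\<^sup>2) \<le> 1"
      using bessel
    proof eventually_elim
      fix \<xi> assume "(\<Sum>i\<in>insert 0 L. (cmod (fourier (g i) \<xi>))\<^sup>2) \<le> 1"
      moreover have "(cmod (fourier \<phi> \<xi>))\<^sup>2 \<le> (cmod (fourier (g 0) \<xi>))\<^sup>2"
        by (intro power_mono fourier_\<phi>) simp
      moreover have "(\<Sum>i\<in>insert 0 L. (cmod (fourier (g i) \<xi>))\<^sup>2) =
          (cmod (fourier (g 0) \<xi>))\<^sup>2 + (\<Sum>i\<in>L. (cmod (fourier (g i) \<xi>))\<^sup>2)"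
        using L by simp
      ultimately show "(cmod (fourier \<phi> \<xi>))\<^sup>2 + (\<Sum>i\<in>L. (cmod (fourier (g i) \<xi>))\<^sup>2) \<le> 1"
        by linarith
    qed
  qed (use L g g2 \<phi> f in auto)
  finally show ?thesis by (simp add: mult_left_mono)
qed

section \<open>Lebesgue measurable functions and infinitely many paths\<close>

lemma ennreal_sqrt_power2: "(ennreal_sqrt s)\<^sup>2 = s"
  by (cases s) (auto simp: ennreal_sqrt_def ennreal_power power2_eq_square ennreal_mult_top simp flip: ennreal_mult)

lemma ennreal_sqrt_le:
  assumes "s \<le> ennreal r" "r \<ge> 0"
  shows "ennreal_sqrt s \<le> ennreal (sqrt r)"
  using assms by (cases s) (auto simp: ennreal_sqrt_def top_unique)

text \<open>A sum of nonnegative terms is the supremum of its finite partial sums, so it suffices to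
  bound these uniformly. For finitely many paths the estimate for Borel representatives
  applies.\<close>

lemma scattering_translate_bound:
  fixes g :: "'i::zero \<Rightarrow> 'a::euclidean_space \<Rightarrow> complex"
  assumes "bessel_with_output \<Lambda> g" and f: "f \<in> L2"
    and \<epsilon>: "\<epsilon> > 0" "\<And>\<xi>. fourier (g 0) \<xi> \<noteq> 0 \<Longrightarrow> 2 * pi * (norm c * norm \<xi>) \<le> \<epsilon>"
  shows "L2l2_norm (lists \<Lambda>) (\<lambda>p x. scattering g f p x - scattering g (translate c f) p x) \<le>
    ennreal (\<epsilon> * sqrt (LINT x|lebesgue. (cmod (f x))\<^sup>2))"
proof -
  have \<Lambda>: "0 \<notin> \<Lambda>" and gL: "\<And>i. i \<in> insert 0 \<Lambda> \<Longrightarrow> g i \<in> L1 \<inter> L2"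
    and bessel: "AE \<xi> in lborel. (\<Sum>\<^sub>\<infinity>i\<in>insert 0 \<Lambda>. ennreal ((cmod (fourier (g i) \<xi>))\<^sup>2)) \<le> 1"
    using assms(1) by (auto simp: bessel_with_output_def semidiscrete_bessel_def AE_completion_iff)
  have "\<forall>i\<in>insert 0 \<Lambda>. \<exists>g'. g' \<in> borel_measurable borel \<and> (AE x in lborel. g i x = g' x)"
    using gL borel_representative_complex unfolding L2_def by blast
  then obtain g' where g'_meas: "\<And>i. i \<in> insert 0 \<Lambda> \<Longrightarrow> g' i \<in> borel_measurable borel"
    and g'_eq: "\<And>i. i \<in> insert 0 \<Lambda> \<Longrightarrow> AE x in lborel. g i x = g' i x"
    by metis
  have "f \<in> borel_measurable lebesgue" using f by (simp add: L2_def)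
  then obtain f' where f' [measurable]: "f' \<in> borel_measurable borel" and f'_eq: "AE x in lborel. f x = f' x"
    using borel_representative_complex by blast
  have L2_rep: "integrable lborel (\<lambda>x. (cmod (u' x))\<^sup>2)"
    "(LINT x|lebesgue. (cmod (u x))\<^sup>2) = (LINT x|lborel. (cmod (u' x))\<^sup>2)"
    if "u \<in> L2" and [measurable]: "u' \<in> borel_measurable borel" and eq: "AE x in lborel. u x = u' x" for u u' :: "'a \<Rightarrow> complex"
  proof -
    have u2: "integrable lebesgue (\<lambda>x. (cmod (u x))\<^sup>2)" using \<open>u \<in> L2\<close> by (simp add: L2_def)
    have m: "(\<lambda>x. (cmod (u' x))\<^sup>2) \<in> borel_measurable lborel" by measurable
    have eq': "AE x in lebesgue. (cmod (u x))\<^sup>2 = (cmod (u' x))\<^sup>2"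
      using AE_completion[OF eq] by eventually_elim simp
    have "integrable lebesgue (\<lambda>x. (cmod (u' x))\<^sup>2)"
      by (rule integrable_cong_AE_imp[OF u2 measurable_completion[OF m]]) (use eq' in \<open>auto simp: eq_commute\<close>)
    then show "integrable lborel (\<lambda>x. (cmod (u' x))\<^sup>2)" using integrable_completion[OF m] by simp
    have "(LINT x|lebesgue. (cmod (u x))\<^sup>2) = (LINT x|lebesgue. (cmod (u' x))\<^sup>2)"
      using u2 measurable_completion[OF m] eq' by (intro integral_cong_AE) auto
    then show "(LINT x|lebesgue. (cmod (u x))\<^sup>2) = (LINT x|lborel. (cmod (u' x))\<^sup>2)"
      using integral_completion[OF m] by simp
  qed
  have L1_rep: "integrable lborel u'"
    if "u \<in> L1" "u' \<in> borel_measurable borel" and eq: "AE x in lborel. u x = u' x" for u u' :: "'a \<Rightarrow> complex"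
  proof -
    have m: "u' \<in> borel_measurable lborel" using that(2) by simp
    have "integrable lebesgue u" using \<open>u \<in> L1\<close> by (simp add: L1_def)
    then have "integrable lebesgue u'"
      by (rule integrable_cong_AE_imp[OF _ measurable_completion[OF m]])
         (use AE_completion[OF eq] in \<open>auto simp: eq_commute\<close>)
    then show ?thesis using integrable_completion[OF m] by simp
  qed
  have fourier_eq: "fourier (g i) = fourier (g' i)" if "i \<in> insert 0 \<Lambda>" for i
    using that by (intro fourier_cong_AE g'_eq g'_meas)
  \<comment> \<open>Equality at every point, even for the empty path, because of the final
    convolution with the output function.\<close>
  have scat: "scattering g u p = scattering g' u' p"
    if "AE x in lborel. u x = u' x" "u' \<in> borel_measurable borel" "p \<in> lists \<Lambda>" for u u' p
    unfolding scattering_def using that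
    by (intro ext conv_cong_AE propagator_cong_AE borel_measurable_propagator g'_eq g'_meas) auto
  let ?I = "LINT x|lebesgue. (cmod (f x))\<^sup>2"
  have I: "(\<integral>\<^sup>+x. ennreal ((cmod (f' x))\<^sup>2) \<partial>lborel) = ennreal ?I"
    using L2_rep[OF f f' f'_eq] by (simp add: nn_integral_eq_integral)
  have fin: "(\<Sum>p\<in>P. (L2_norm (\<lambda>x. scattering g f p x - scattering g (translate c f) p x))\<^sup>2) \<le> ennreal (\<epsilon>\<^sup>2 * ?I)"
    if P: "finite P" "P \<subseteq> lists \<Lambda>" for P
  proof -
    \<comment> \<open>The finitely many indices that occur in \<open>P\<close>. Their Bessel sum is
      a partial sum of the one over \<open>\<Lambda>\<close>, hence still at most 1.\<close>
    define L where "L = (\<Union>p\<in>P. set p)"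
    have L: "finite L" "L \<subseteq> \<Lambda>" "P \<subseteq> lists L" using P by (auto simp: L_def)
    have tr: "AE x in lborel. translate c f x = translate c f' x"
      unfolding translate_def using f'_eq by (rule AE_lborel_translate)
    have "(\<Sum>p\<in>P. (L2_norm (\<lambda>x. scattering g f p x - scattering g (translate c f) p x))\<^sup>2)
      = (\<Sum>p\<in>P. \<integral>\<^sup>+x. ennreal ((cmod (scattering g' f' p x - scattering g' (translate c f') p x))\<^sup>2) \<partial>lborel)"
    proof (intro sum.cong refl)
      fix p assume "p \<in> P"
      with P have "p \<in> lists \<Lambda>" by auto
      then have "scattering g f p = scattering g' f' p"
        "scattering g (translate c f) p = scattering g' (translate c f') p"
        by (auto intro!: scat f'_eq f' tr borel_measurable_translate)
      then show "(L2_norm (\<lambda>x. scattering g f p x - scattering g (translate c f) p x))\<^sup>2 =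
          (\<integral>\<^sup>+x. ennreal ((cmod (scattering g' f' p x - scattering g' (translate c f') p x))\<^sup>2) \<partial>lborel)"
        by (simp add: L2_norm_def ennreal_sqrt_power2 nn_integral_completion)
    qed
    also have "\<dots> \<le> ennreal (\<epsilon>\<^sup>2) * (\<integral>\<^sup>+x. ennreal ((cmod (f' x))\<^sup>2) \<partial>lborel)"
    proof (rule scattering_translate_energy[OF P(1) L(3,1)])
      show "0 \<notin> L" using L \<Lambda> by auto
      show "integrable lborel (g' i)" "integrable lborel (\<lambda>x. (cmod (g' i x))\<^sup>2)" if "i \<in> insert 0 L" for i
        using that L gL[of i] g'_meas[of i] g'_eq[of i] by (auto intro: L1_rep L2_rep(1))
      show "2 * pi * (norm c * norm \<xi>) \<le> \<epsilon>" if "fourier (g' 0) \<xi> \<noteq> 0" for \<xi>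
        using that \<epsilon>(2) fourier_eq[of 0] by simp
      show "AE \<xi> in lborel. (\<Sum>i\<in>insert 0 L. (cmod (fourier (g' i) \<xi>))\<^sup>2) \<le> 1"
        using bessel
      proof eventually_elim
        fix \<xi> assume le: "(\<Sum>\<^sub>\<infinity>i\<in>insert 0 \<Lambda>. ennreal ((cmod (fourier (g i) \<xi>))\<^sup>2)) \<le> 1"
        have "ennreal (\<Sum>i\<in>insert 0 L. (cmod (fourier (g' i) \<xi>))\<^sup>2) =
            (\<Sum>i\<in>insert 0 L. ennreal ((cmod (fourier (g i) \<xi>))\<^sup>2))"
          using L(2) fourier_eq by (subst sum_ennreal[symmetric]) (auto intro!: sum.cong simp del: sum_ennreal)
        also have "\<dots> \<le> (\<Sum>\<^sub>\<infinity>i\<in>insert 0 \<Lambda>. ennreal ((cmod (fourier (g i) \<xi>))\<^sup>2))"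
          using L(1,2) by (subst nonneg_infsum_complete) (auto intro: SUP_upper)
        also note le
        finally show "(\<Sum>i\<in>insert 0 L. (cmod (fourier (g' i) \<xi>))\<^sup>2) \<le> 1"
          by (simp add: ennreal_le_1)
      qed
      show "integrable lborel (\<lambda>x. (cmod (f' x))\<^sup>2)" by (rule L2_rep(1)[OF f f' f'_eq])
    qed (use \<epsilon> f' in auto)
    also have "\<dots> = ennreal (\<epsilon>\<^sup>2 * ?I)" by (simp add: I ennreal_mult)
    finally show ?thesis .
  qed
  have "(\<Sum>\<^sub>\<infinity>p\<in>lists \<Lambda>. (L2_norm (\<lambda>x. scattering g f p x - scattering g (translate c f) p x))\<^sup>2) \<le> ennreal (\<epsilon>\<^sup>2 * ?I)"
    by (subst nonneg_infsum_complete) (auto intro!: SUP_least fin)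
  then have "L2l2_norm (lists \<Lambda>) (\<lambda>p x. scattering g f p x - scattering g (translate c f) p x) \<le> ennreal (sqrt (\<epsilon>\<^sup>2 * ?I))"
    unfolding L2l2_norm_def by (intro ennreal_sqrt_le) auto
  then show ?thesis using \<epsilon>(1) by (simp add: real_sqrt_mult)
qed

theorem corollary3p2:
  fixes \<Lambda> :: "nat \<Rightarrow> 'i::zero set"
    and G :: "nat \<Rightarrow> 'i \<Rightarrow> 'a::euclidean_space \<Rightarrow> complex"
    and f :: "'a \<Rightarrow> complex"
    and c :: 'a
  assumes "coherent \<Lambda> G"
    and "f \<in> L2"
  shows "(\<lambda>J. L2l2_norm (lists (\<Lambda> J))
            (\<lambda>p x. scattering (G J) f p x - scattering (G J) (translate c f) p x)) \<longlonglongrightarrow> 0"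
proof -
  define r where "r J = (SUP \<xi>\<in>{\<xi>. fourier (G J 0) \<xi> \<noteq> 0}. ennreal (norm \<xi>))" for J
  have r: "r \<longlonglongrightarrow> 0" and bwo: "\<And>J. bessel_with_output (\<Lambda> J) (G J)"
    using assms(1) unfolding coherent_def r_def[abs_def] by blast+
  \<comment> \<open>The last summand keeps \<epsilon> positive when \<open>c\<close> or the radius
    is zero, as the division by \<epsilon> requires; it vanishes in the limit.\<close>
  define \<epsilon> where "\<epsilon> J = 2 * pi * (norm c * enn2real (r J)) + inverse (real (Suc J))" for J
  let ?N = "sqrt (LINT x|lebesgue. (cmod (f x))\<^sup>2)"
  have \<epsilon>_pos: "\<epsilon> J > 0" for J by (auto simp: \<epsilon>_def intro!: add_nonneg_pos)
  have "(\<lambda>J. enn2real (r J)) \<longlonglongrightarrow> 0"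
    using tendsto_enn2real[of r 0] r by simp
  then have "\<epsilon> \<longlonglongrightarrow> 2 * pi * (norm c * 0) + 0"
    unfolding \<epsilon>_def by (intro tendsto_add tendsto_mult tendsto_const LIMSEQ_inverse_real_of_nat)
  then have "(\<lambda>J. ennreal (\<epsilon> J * ?N)) \<longlonglongrightarrow> ennreal (0 * ?N)"
    by (intro tendsto_ennrealI tendsto_intros) simp
  then have lim: "(\<lambda>J. ennreal (\<epsilon> J * ?N)) \<longlonglongrightarrow> 0" by simp
  \<comment> \<open>Any finite bound would do: it excludes \<open>r J = top\<close>, where
    \<open>enn2real\<close> returns 0 and would not bound the norms in the support.\<close>
  have "\<forall>\<^sub>F J in sequentially. r J < 1"
    using order_tendstoD(2)[OF r, of 1] by simp
  then have "\<forall>\<^sub>F J in sequentially. L2l2_norm (lists (\<Lambda> J))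
      (\<lambda>p x. scattering (G J) f p x - scattering (G J) (translate c f) p x) \<le> ennreal (\<epsilon> J * ?N)"
  proof eventually_elim
    fix J assume rJ: "r J < 1"
    show "L2l2_norm (lists (\<Lambda> J))
      (\<lambda>p x. scattering (G J) f p x - scattering (G J) (translate c f) p x) \<le> ennreal (\<epsilon> J * ?N)"
    proof (rule scattering_translate_bound[OF bwo assms(2) \<epsilon>_pos])
      fix \<xi> assume "fourier (G J 0) \<xi> \<noteq> 0"
      then have "ennreal (norm \<xi>) \<le> r J" unfolding r_def by (intro SUP_upper) simp
      moreover have "r J < top" using rJ by (rule order.strict_trans) simp
      ultimately have "norm \<xi> \<le> enn2real (r J)"
        by (metis enn2real_ennreal enn2real_mono norm_ge_zero)
      then have "2 * pi * (norm c * norm \<xi>) \<le> 2 * pi * (norm c * enn2real (r J))"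
        by (intro mult_left_mono) auto
      then show "2 * pi * (norm c * norm \<xi>) \<le> \<epsilon> J" by (simp add: \<epsilon>_def add_increasing2)
    qed
  qed
  then show ?thesis
    by (intro tendsto_sandwich[OF _ _ tendsto_const lim]) auto
qed

end
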